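(* There exists a constant $C_3<\infty$ (depending on $\theta$, $\sigma$ and $K_h$) such that for each $r\in[-K_h,0]$, $x\ge r$ and $T\ge1$, $$\mathbb E_x\left[\left|\frac1T\int_0^T\left(Z_r(t)-r\right)dt-\frac1\gamma\right|^2\right]\le\frac{C_3(1+|x|^4)}{T}.$$
   Context: $B$ is a standard Brownian motion; $\theta<0$, $\sigma>0$, $\gamma:=-2\theta/\sigma^2$. $Z_r$ is the reflected Brownian motion on $[r,\infty)$ started at $x$: $(Z_r,Y_r)$ is the unique continuous adapted pair with $Z_r(t)=x+\theta t+\sigma B(t)+Y_r(t)\ge r$, $Y_r$ nondecreasing, $Y_r(0)=0$, $\int_0^t\mathbf 1_{\{Z_r(u)>r\}}\,dY_r(u)=0$ for all $t\ge0$. $\mathbb E_x$ is expectation with initial state $Z_r(0)=x$. $K_h>0$ is a fixed constant (in the paper, one such that all optimal reflection levels lie in $(-K_h,0)$; only its positivity matters here). *)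

theory Defs
  imports "HOL-Probability.Probability"
begin

text \<open>
  Continuous-time processes are functions \<open>real \<Rightarrow> 'a \<Rightarrow> real\<close> of which only the values at times
  \<open>t \<ge> 0\<close> are constrained.  Likewise only \<open>F t\<close> with \<open>t \<ge> 0\<close> is used of a filtration; a filtration
  indexed by the nonnegative reals extends to all reals by \<open>F t = F 0\<close> for \<open>t < 0\<close>.
\<close>

definition adapted_process :: "(real \<Rightarrow> 'a measure) \<Rightarrow> (real \<Rightarrow> 'a \<Rightarrow> real) \<Rightarrow> bool" where
  "adapted_process F X \<longleftrightarrow> (\<forall>t\<ge>0. X t \<in> borel_measurable (F t))"

text \<open>
  Standard Brownian motion relative to a filtration \<open>F\<close> (which may be, but need not be, its natural
  one).  Initial value and path continuity are only required almost surely.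
\<close>

definition standard_brownian_motion ::
  "'a measure \<Rightarrow> (real \<Rightarrow> 'a measure) \<Rightarrow> (real \<Rightarrow> 'a \<Rightarrow> real) \<Rightarrow> bool" where
  "standard_brownian_motion M F B \<longleftrightarrow>
     prob_space M \<and> filtration (space M) F \<and> (\<forall>t. subalgebra M (F t)) \<and>
     adapted_process F B \<and>
     (AE \<omega> in M. B 0 \<omega> = 0 \<and> continuous_on {0..} (\<lambda>t. B t \<omega>)) \<and>
     (\<forall>s t. 0 \<le> s \<and> s < t \<longrightarrow>
        distributed M lborel (\<lambda>\<omega>. B t \<omega> - B s \<omega>) (normal_density 0 (sqrt (t - s))) \<and>
        prob_space.indep_set M (sets (F s))
          (sets (vimage_algebra (space M) (\<lambda>\<omega>. B t \<omega> - B s \<omega>) borel)))"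

text \<open>
  Reflected Brownian motion \<open>Z\<close> on \<open>[r, \<infinity>)\<close> with drift \<open>\<theta>\<close>, variance \<open>\<sigma>\<^sup>2\<close>, started at \<open>x\<close>, with its
  regulator \<open>Y\<close>.  The Lebesgue-Stieltjes measure \<open>dY\<close> is \<open>interval_measure\<close> of the path of \<open>Y\<close>
  extended by the constant \<open>Y 0\<close> to negative times, so it has no mass on \<open>{..0}\<close>.
\<close>

definition reflected_brownian_motion ::
  "'a measure \<Rightarrow> (real \<Rightarrow> 'a measure) \<Rightarrow> (real \<Rightarrow> 'a \<Rightarrow> real) \<Rightarrow> real \<Rightarrow> real \<Rightarrow> real \<Rightarrow> real \<Rightarrow>
   (real \<Rightarrow> 'a \<Rightarrow> real) \<Rightarrow> (real \<Rightarrow> 'a \<Rightarrow> real) \<Rightarrow> bool" where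
  "reflected_brownian_motion M F B \<theta> \<sigma> r x Z Y \<longleftrightarrow>
     adapted_process F Z \<and> adapted_process F Y \<and>
     (AE \<omega> in M.
        continuous_on {0..} (\<lambda>t. Z t \<omega>) \<and> continuous_on {0..} (\<lambda>t. Y t \<omega>) \<and>
        (\<forall>t\<ge>0. Z t \<omega> = x + \<theta> * t + \<sigma> * B t \<omega> + Y t \<omega> \<and> Z t \<omega> \<ge> r) \<and>
        mono_on {0..} (\<lambda>t. Y t \<omega>) \<and> Y 0 \<omega> = 0 \<and>
        (\<forall>t\<ge>0. (\<integral>\<^sup>+ u\<in>{0..t}. indicator {u. Z u \<omega> > r} u
                  \<partial>interval_measure (\<lambda>s. Y (max 0 s) \<omega>)) = 0))"

end

theory Submission
  imports Defs
begin

text \<open>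
  Write \<open>W = Z - r\<close> and \<open>w = x - r\<close>. Since the regulator \<open>Y\<close> grows only while \<open>W = 0\<close>, Ito's formula
  for \<open>W\<^sup>2\<close> contains no \<open>dY\<close> term:

  \<open>W(T)\<^sup>2 - w\<^sup>2 = 2 \<theta> \<integral>\<^sub>0\<^sup>T W dt + 2 \<sigma> \<integral>\<^sub>0\<^sup>T W dB + \<sigma>\<^sup>2 T\<close>.

  As \<open>1 / \<gamma> = - \<sigma>\<^sup>2 / (2 \<theta>)\<close>, the error \<open>(1 / T) \<integral>\<^sub>0\<^sup>T W dt - 1 / \<gamma>\<close> is
  \<open>(W(T)\<^sup>2 - w\<^sup>2 - 2 \<sigma> \<integral>\<^sub>0\<^sup>T W dB) / (2 \<theta> T)\<close>. Its second moment has the order \<open>1 / T\<close>, because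
  the stochastic integral has variance at most of order \<open>T\<close>, provided that the fourth moment of \<open>W(t)\<close>
  is bounded by a multiple of \<open>1 + w\<^sup>4\<close> uniformly in \<open>t\<close>.

  The proof replaces stochastic integration by sums over the grid with step \<open>h = T / n\<close>. The
  stochastic integral together with the fluctuation of the quadratic variation becomes a sum of the
  martingale differences \<open>2 \<sigma> W \<Delta>B + \<sigma>\<^sup>2 ((\<Delta>B)\<^sup>2 - h)\<close>; these are orthogonal, which gives the
  bound \<open>martingale_sum_second_moment\<close>. For a single path the discrete energy identity has an error
  bounded by the modulus of continuity times \<open>\<bar>\<theta>\<bar> T + Y(T)\<close>, so it becomes exact as \<open>n\<close> grows
  (\<open>energy_limit\<close>), and Fatou's lemma carries the second moment bound to the limit.

  The fourth moment of \<open>W(t)\<close> comes from a comparison on a grid of \<open>{0..t}\<close>. Up to the oscillation of the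
  path over one step, \<open>W\<close> lies below \<open>w + L\<close>, where \<open>L\<close> is the Lindley recursion
  \<open>L' = max 0 (L + \<theta> h + \<sigma> \<Delta>B)\<close> started at 0 (\<open>below_lindley\<close>). With \<open>a = - \<theta> / \<sigma>\<^sup>2\<close>, the
  expectation of \<open>exp (a L) + exp (- a L)\<close> satisfies a linear recursive inequality whose fixed point is bounded
  as \<open>h\<close> tends to 0 (\<open>drifted_lindley_exponential_moment\<close>). The symmetric function matters here: its
  derivative vanishes at 0, so truncation at 0 costs nothing, whereas truncation in a step from 0 raises
  \<open>exp (a L)\<close> by an amount of order \<open>sqrt h\<close>, too much to be summed over steps of length \<open>h\<close>.
\<close>

section \<open>A single reflected path\<close>

locale reflected_path =
  fixes \<theta> \<sigma> r x :: real and b z y :: "real \<Rightarrow> real"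
  assumes cont_b: "continuous_on {0..} b"
    and cont_z: "continuous_on {0..} z"
    and cont_y: "continuous_on {0..} y"
    and b_0: "b 0 = 0"
    and y_0: "y 0 = 0"
    and decomposition: "0 \<le> t \<Longrightarrow> z t = x + \<theta> * t + \<sigma> * b t + y t"
    and above: "0 \<le> t \<Longrightarrow> r \<le> z t"
    and mono_y: "mono_on {0..} y"
    and complementarity: "0 \<le> t \<Longrightarrow>
      (\<integral>\<^sup>+ u\<in>{0..t}. indicator {u. z u > r} u \<partial>interval_measure (\<lambda>s. y (max 0 s))) = 0"
begin

lemma z_0: "z 0 = x"
  using decomposition[of 0] b_0 y_0 by simp

text \<open>
  The complementarity condition in pathwise form: the measure \<open>dY\<close> of \<open>{s<..t}\<close> is \<open>y t - y s\<close>, and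
  it vanishes when the whole interval lies off the boundary.
\<close>

lemma regulator_flat_off_boundary:
  assumes "0 \<le> s" "s \<le> t" and off: "\<And>u. u \<in> {s..t} \<Longrightarrow> r < z u"
  shows "y s = y t"
proof -
  let ?G = "\<lambda>s. y (max 0 s)"
  have mono_G: "\<And>u v. u \<le> v \<Longrightarrow> ?G u \<le> ?G v"
    using mono_y by (auto simp: mono_on_def)
  have "continuous_on UNIV ?G"
    by (rule continuous_on_compose2[OF cont_y]) (auto intro!: continuous_intros)
  then have cont_G: "\<And>a. continuous (at_right a) ?G"
    by (simp add: continuous_on_eq_continuous_at continuous_at_imp_continuous_at_within)
  have "ennreal (y t - y s) = emeasure (interval_measure ?G) {s<..t}"
    using emeasure_interval_measure_Ioc[OF \<open>s \<le> t\<close> mono_G cont_G] assms(1,2) by simp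
  also have "\<dots> = (\<integral>\<^sup>+ u. indicator {s<..t} u \<partial>interval_measure ?G)"
    by simp
  also have "\<dots> \<le> (\<integral>\<^sup>+ u\<in>{0..t}. indicator {u. z u > r} u \<partial>interval_measure ?G)"
    using assms(1) off by (intro nn_integral_mono) (auto split: split_indicator)
  also have "\<dots> = 0"
    using complementarity assms(1,2) by auto
  finally have "y t \<le> y s"
    by (simp add: ennreal_eq_0_iff)
  moreover have "y s \<le> y t"
    using mono_y assms(1,2) by (auto simp: mono_on_def)
  ultimately show ?thesis by simp
qed

text \<open>
  Both pathwise estimates below rest on this: in a grid step in which the regulator moves, \<open>z - r\<close> is
  at most its oscillation over that step.
\<close>

lemma boundary_hit_if_regulator_increases:
  assumes "0 \<le> s" "s \<le> t" "y s \<noteq> y t"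
  obtains u where "u \<in> {s..t}" "z u = r"
proof -
  have "\<exists>u\<in>{s..t}. \<not> r < z u"
    using regulator_flat_off_boundary assms by blast
  then obtain u where u: "u \<in> {s..t}" "\<not> r < z u" by blast
  with above[of u] assms(1) have "z u = r" by auto
  with u that show thesis by blast
qed

lemma grid_modulus:
  assumes "0 < \<delta>" "0 < T"
  shows "\<forall>\<^sub>F n in sequentially. \<forall>u\<in>{0..T}. \<forall>v\<in>{0..T}. \<bar>u - v\<bar> \<le> T / real n \<longrightarrow>
    \<bar>z u - z v\<bar> \<le> \<delta> \<and> \<bar>\<sigma> * b u - \<sigma> * b v\<bar> \<le> \<delta>"
proof -
  have "uniformly_continuous_on {0..T} (\<lambda>u. (z u, \<sigma> * b u))"
    by (intro compact_uniformly_continuous compact_Icc continuous_intros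
        continuous_on_subset[OF cont_z] continuous_on_subset[OF cont_b]) auto
  then obtain d where "0 < d"
    and d: "\<And>u v. u \<in> {0..T} \<Longrightarrow> v \<in> {0..T} \<Longrightarrow> dist v u < d \<Longrightarrow>
      dist (z v, \<sigma> * b v) (z u, \<sigma> * b u) < \<delta>"
    using assms(1) unfolding uniformly_continuous_on_def by metis
  have "(\<lambda>n. T / real n) \<longlonglongrightarrow> 0"
    by (rule lim_const_over_n)
  then have "\<forall>\<^sub>F n in sequentially. T / real n < d"
    using \<open>0 < d\<close> by (rule order_tendstoD)
  then show ?thesis
  proof eventually_elim
    case (elim n)
    show ?case
    proof (intro ballI impI)
      fix u v assume uv: "u \<in> {0..T}" "v \<in> {0..T}" "\<bar>u - v\<bar> \<le> T / real n"
      then have "dist (z u, \<sigma> * b u) (z v, \<sigma> * b v) < \<delta>"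
        using elim by (intro d) (auto simp: dist_real_def)
      moreover have "dist (z u) (z v) \<le> dist (z u, \<sigma> * b u) (z v, \<sigma> * b v)"
        using dist_fst_le[of "(z u, \<sigma> * b u)" "(z v, \<sigma> * b v)"] by simp
      moreover have "dist (\<sigma> * b u) (\<sigma> * b v) \<le> dist (z u, \<sigma> * b u) (z v, \<sigma> * b v)"
        using dist_snd_le[of "(z u, \<sigma> * b u)" "(z v, \<sigma> * b v)"] by simp
      ultimately show "\<bar>z u - z v\<bar> \<le> \<delta> \<and> \<bar>\<sigma> * b u - \<sigma> * b v\<bar> \<le> \<delta>"
        by (auto simp: dist_real_def)
    qed
  qed
qed

end

text \<open>
  The waiting time recursion of queueing theory, which is the reflection at 0 of the random walk with
  increments \<open>X\<close>.
\<close>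

primrec lindley :: "(nat \<Rightarrow> real) \<Rightarrow> nat \<Rightarrow> real" where
  "lindley X 0 = 0"
| "lindley X (Suc k) = max 0 (lindley X k + X k)"

lemma lindley_nonneg: "0 \<le> lindley X k"
  by (cases k) auto

lemma grid_step:
  fixes h :: real
  assumes "0 \<le> h"
  shows "0 \<le> real k * h" "real k * h \<le> real (Suc k) * h"
    "real (Suc k) * h - real k * h = h"
    "k < n \<Longrightarrow> {real k * h..real (Suc k) * h} \<subseteq> {0..real n * h}"
    "u \<in> {real k * h..real (Suc k) * h} \<Longrightarrow> v \<in> {real k * h..real (Suc k) * h} \<Longrightarrow> \<bar>u - v\<bar> \<le> h"
proof -
  show 1: "0 \<le> real k * h" and "real k * h \<le> real (Suc k) * h" and
    2: "real (Suc k) * h - real k * h = h"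
    using assms by (auto simp: algebra_simps)
  show "{real k * h..real (Suc k) * h} \<subseteq> {0..real n * h}" if "k < n"
    using 1 mult_right_mono[OF _ assms, of "real (Suc k)" "real n"] that by auto
  show "u \<in> {real k * h..real (Suc k) * h} \<Longrightarrow> v \<in> {real k * h..real (Suc k) * h} \<Longrightarrow> \<bar>u - v\<bar> \<le> h"
    using 2 unfolding atLeastAtMost_iff by linarith
qed

context reflected_path
begin

text \<open>
  The oscillation \<open>\<delta>\<close> enters once and does not accumulate. In a step without regulation, \<open>z\<close> and the
  recursion receive the same increment; in a step with regulation, \<open>z\<close> visits \<open>r\<close> and is therefore
  within \<open>\<delta>\<close> of it at the end, whatever happened before.
\<close>

lemma below_lindley:
  assumes "0 \<le> h" "0 \<le> \<delta>" "r \<le> x"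
    and osc: "\<And>u v. u \<in> {0..real n * h} \<Longrightarrow> v \<in> {0..real n * h} \<Longrightarrow> \<bar>u - v\<bar> \<le> h \<Longrightarrow>
      \<bar>z u - z v\<bar> \<le> \<delta>"
    and "k \<le> n"
  shows "z (real k * h) - r \<le>
    (x - r) + \<delta> + lindley (\<lambda>i. \<theta> * h + \<sigma> * (b (real (Suc i) * h) - b (real i * h))) k"
    (is "_ \<le> _ + lindley ?X k")
  using \<open>k \<le> n\<close>
proof (induction k)
  case 0
  then show ?case using z_0 assms by simp
next
  case (Suc k)
  let ?s = "real k * h" and ?t = "real (Suc k) * h"
  note st = grid_step(1-3)[OF \<open>0 \<le> h\<close>, of k]
  have sub: "{?s..?t} \<subseteq> {0..real n * h}"
    using grid_step(4)[OF \<open>0 \<le> h\<close>] Suc.prems by auto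
  show ?case
  proof (cases "y ?s = y ?t")
    case True
    have "z ?t = z ?s + ?X k"
      using decomposition[of ?s] decomposition[of ?t] st True by (simp add: algebra_simps)
    moreover have "lindley ?X k + ?X k \<le> lindley ?X (Suc k)" by simp
    ultimately show ?thesis using Suc.IH Suc.prems by simp
  next
    case False
    then obtain u where u: "u \<in> {?s..?t}" "z u = r"
      using boundary_hit_if_regulator_increases st by metis
    have "\<bar>z ?t - z u\<bar> \<le> \<delta>"
      using u(1) st(2) sub by (intro osc grid_step(5)[OF \<open>0 \<le> h\<close>]) auto
    then have "z ?t - r \<le> \<delta>" using u(2) by simp
    then show ?thesis using lindley_nonneg[of ?X "Suc k"] assms by linarith
  qed
qed

lemma integral_step:
  assumes "0 \<le> s" "s \<le> t" and osc: "\<And>u. u \<in> {s..t} \<Longrightarrow> \<bar>z u - z s\<bar> \<le> \<delta>"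
  shows "\<bar>integral {0..t} (\<lambda>u. z u - r) - integral {0..s} (\<lambda>u. z u - r) - (z s - r) * (t - s)\<bar>
    \<le> \<delta> * (t - s)"
proof -
  have cont: "continuous_on {c..d} (\<lambda>u. z u - r)" if "0 \<le> c" for c d
    using that by (intro continuous_intros continuous_on_subset[OF cont_z]) auto
  have "integral {0..t} (\<lambda>u. z u - r) - integral {0..s} (\<lambda>u. z u - r)
      = integral {s..t} (\<lambda>u. z u - r)"
    using Henstock_Kurzweil_Integration.integral_combine[of 0 s t "\<lambda>u. z u - r"] assms(1,2)
      cont[of 0 t] by (simp add: integrable_continuous_interval)
  moreover have "integral {s..t} (\<lambda>u. z u - z s) = integral {s..t} (\<lambda>u. z u - r) - (z s - r) * (t - s)"
  proof -
    have "integral {s..t} (\<lambda>u. (z u - r) - (z s - r)) =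
        integral {s..t} (\<lambda>u. z u - r) - integral {s..t} (\<lambda>u. z s - r)"
      using assms(1) by (intro Henstock_Kurzweil_Integration.integral_diff integrable_continuous_interval cont) auto
    then show ?thesis using assms(2) by simp
  qed
  moreover have "norm (integral {s..t} (\<lambda>u. z u - z s)) \<le> \<delta> * (t - s)"
    using assms by (intro integral_bound continuous_intros continuous_on_subset[OF cont_z]) auto
  ultimately show ?thesis by simp
qed

text \<open>
  The discrete form of Ito's formula for \<open>(z - r)\<^sup>2\<close> over one step. Every error term is a product of
  an oscillation and of an increment of \<open>\<bar>\<theta>\<bar> t + y t\<close>: the Riemann sum error, the term
  \<open>(z s - r) (y t - y s)\<close>, which is small since \<open>y\<close> moves only near the boundary, and the difference
  between \<open>(\<Delta>z)\<^sup>2\<close> and \<open>\<sigma>\<^sup>2 (\<Delta>b)\<^sup>2\<close>. Since these increments telescope, the errors of all steps add up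
  to one oscillation times a number that does not depend on the grid.
\<close>

lemma energy_step:
  assumes "0 \<le> s" "s \<le> t" "0 \<le> \<delta>"
    and osc: "\<And>u v. u \<in> {s..t} \<Longrightarrow> v \<in> {s..t} \<Longrightarrow>
      \<bar>z u - z v\<bar> \<le> \<delta> \<and> \<bar>\<sigma> * b u - \<sigma> * b v\<bar> \<le> \<delta>"
  defines "I \<equiv> \<lambda>t. integral {0..t} (\<lambda>u. z u - r)"
  shows "\<bar>(z t - r)\<^sup>2 - (z s - r)\<^sup>2
      - (2 * \<sigma> * (z s - r) * (b t - b s) + \<sigma>\<^sup>2 * ((b t - b s)\<^sup>2 - (t - s)))
      - 2 * \<theta> * (I t - I s) - \<sigma>\<^sup>2 * (t - s)\<bar>
    \<le> 4 * \<delta> * (\<bar>\<theta>\<bar> * (t - s) + (y t - y s))"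
    (is "\<bar>?E\<bar> \<le> _")
proof -
  define w D \<eta> h where "w = z s - r" and "D = z t - z s" and "\<eta> = y t - y s" and "h = t - s"
  define \<beta> where "\<beta> = \<sigma> * (b t - b s)"
  have D: "D = \<theta> * h + \<beta> + \<eta>"
    using decomposition[of s] decomposition[of t] assms(1,2)
    by (simp add: D_def \<eta>_def h_def \<beta>_def algebra_simps)
  have "0 \<le> \<eta>" using mono_y assms(1,2) by (auto simp: \<eta>_def mono_on_def)
  have "0 \<le> h" using assms(2) by (simp add: h_def)
  have "0 \<le> w" using above assms(1) by (simp add: w_def)
  have D_le: "\<bar>D\<bar> \<le> \<delta>" and \<beta>_le: "\<bar>\<beta>\<bar> \<le> \<delta>"
    using osc[of t s] assms(2) by (auto simp: D_def \<beta>_def algebra_simps)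
  have I_le: "\<bar>I t - I s - w * h\<bar> \<le> \<delta> * h"
    unfolding I_def w_def h_def using osc assms(1,2) by (intro integral_step) auto
  \<comment> \<open>Regulation happens only in steps that touch the boundary, where \<open>w\<close> is at most the oscillation.\<close>
  have w\<eta>: "w * \<eta> \<le> \<delta> * \<eta>"
  proof (cases "\<eta> = 0")
    case False
    then obtain u where "u \<in> {s..t}" "z u = r"
      using boundary_hit_if_regulator_increases[OF assms(1,2)] by (auto simp: \<eta>_def)
    then have "w \<le> \<delta>" using osc[of s u] assms(2) by (auto simp: w_def)
    then show ?thesis using \<open>0 \<le> \<eta>\<close> by (rule mult_right_mono)
  qed simp
  have "(z t - r)\<^sup>2 - (z s - r)\<^sup>2 = 2 * w * D + D\<^sup>2"
    by (simp add: w_def D_def power2_eq_square algebra_simps)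
  then have "?E = 2 * w * D + D\<^sup>2 - 2 * w * \<beta> - \<beta>\<^sup>2 - 2 * \<theta> * (I t - I s)"
    by (simp add: w_def \<beta>_def h_def power2_eq_square algebra_simps)
  also have "\<dots> = - 2 * \<theta> * (I t - I s - w * h) + 2 * (w * \<eta>) + (\<theta> * h + \<eta>) * (D + \<beta>)"
    unfolding D by (simp add: power2_eq_square algebra_simps)
  finally have "\<bar>?E\<bar> \<le> \<bar>2 * \<theta> * (I t - I s - w * h)\<bar> + \<bar>2 * (w * \<eta>)\<bar> + \<bar>(\<theta> * h + \<eta>) * (D + \<beta>)\<bar>"
    by linarith
  moreover have "\<bar>2 * \<theta> * (I t - I s - w * h)\<bar> \<le> 2 * \<bar>\<theta>\<bar> * (\<delta> * h)"
    using mult_left_mono[OF I_le, of "2 * \<bar>\<theta>\<bar>"] by (simp add: abs_mult)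
  moreover have "\<bar>2 * (w * \<eta>)\<bar> \<le> 2 * (\<delta> * \<eta>)"
    using w\<eta> \<open>0 \<le> w\<close> \<open>0 \<le> \<eta>\<close> by simp
  moreover have "\<bar>(\<theta> * h + \<eta>) * (D + \<beta>)\<bar> \<le> (\<bar>\<theta>\<bar> * h + \<eta>) * (2 * \<delta>)"
    unfolding abs_mult
  proof (rule mult_mono)
    show "\<bar>\<theta> * h + \<eta>\<bar> \<le> \<bar>\<theta>\<bar> * h + \<eta>"
      using abs_triangle_ineq[of "\<theta> * h" \<eta>] \<open>0 \<le> h\<close> \<open>0 \<le> \<eta>\<close> by (simp add: abs_mult)
  qed (use D_le \<beta>_le \<open>0 \<le> h\<close> \<open>0 \<le> \<eta>\<close> in auto)
  moreover have "2 * \<bar>\<theta>\<bar> * (\<delta> * h) + 2 * (\<delta> * \<eta>) + (\<bar>\<theta>\<bar> * h + \<eta>) * (2 * \<delta>)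
      = 4 * \<delta> * (\<bar>\<theta>\<bar> * h + \<eta>)"
    by (simp add: algebra_simps)
  ultimately show ?thesis unfolding h_def \<eta>_def by linarith
qed

definition martingale_increment :: "real \<Rightarrow> nat \<Rightarrow> real" where
  "martingale_increment h i =
    2 * \<sigma> * (z (real i * h) - r) * (b (real (Suc i) * h) - b (real i * h))
    + \<sigma>\<^sup>2 * ((b (real (Suc i) * h) - b (real i * h))\<^sup>2 - h)"

lemma energy_grid:
  assumes "0 \<le> h" "0 \<le> \<delta>"
    and osc: "\<And>u v. u \<in> {0..real n * h} \<Longrightarrow> v \<in> {0..real n * h} \<Longrightarrow> \<bar>u - v\<bar> \<le> h \<Longrightarrow>
      \<bar>z u - z v\<bar> \<le> \<delta> \<and> \<bar>\<sigma> * b u - \<sigma> * b v\<bar> \<le> \<delta>"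
    and "k \<le> n"
  shows "\<bar>(z (real k * h) - r)\<^sup>2 - (x - r)\<^sup>2 - (\<Sum>i<k. martingale_increment h i)
      - 2 * \<theta> * integral {0..real k * h} (\<lambda>u. z u - r) - \<sigma>\<^sup>2 * (real k * h)\<bar>
    \<le> 4 * \<delta> * (\<bar>\<theta>\<bar> * (real k * h) + y (real k * h))"
  using \<open>k \<le> n\<close>
proof (induction k)
  case 0
  then show ?case by (simp add: z_0 y_0)
next
  case (Suc k)
  let ?s = "real k * h" and ?t = "real (Suc k) * h"
  note st = grid_step(1-3)[OF \<open>0 \<le> h\<close>, of k]
  have sub: "{?s..?t} \<subseteq> {0..real n * h}"
    using grid_step(4)[OF \<open>0 \<le> h\<close>] Suc.prems by auto
  have step: "\<bar>(z ?t - r)\<^sup>2 - (z ?s - r)\<^sup>2 - martingale_increment h k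
      - 2 * \<theta> * (integral {0..?t} (\<lambda>u. z u - r) - integral {0..?s} (\<lambda>u. z u - r)) - \<sigma>\<^sup>2 * h\<bar>
    \<le> 4 * \<delta> * (\<bar>\<theta>\<bar> * h + (y ?t - y ?s))"
  proof -
    have "\<bar>z u - z v\<bar> \<le> \<delta> \<and> \<bar>\<sigma> * b u - \<sigma> * b v\<bar> \<le> \<delta>" if "u \<in> {?s..?t}" "v \<in> {?s..?t}" for u v
      using that sub by (intro osc grid_step(5)[OF \<open>0 \<le> h\<close>]) blast+
    from energy_step[OF st(1,2) \<open>0 \<le> \<delta>\<close> this] show ?thesis
      unfolding martingale_increment_def st(3) .
  qed
  let ?I = "\<lambda>t. integral {0..t} (\<lambda>u. z u - r)"
  let ?P = "(z ?t - r)\<^sup>2 - (z ?s - r)\<^sup>2 - martingale_increment h k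
      - 2 * \<theta> * (?I ?t - ?I ?s) - \<sigma>\<^sup>2 * h"
  let ?Q = "(z ?s - r)\<^sup>2 - (x - r)\<^sup>2 - (\<Sum>i<k. martingale_increment h i)
      - 2 * \<theta> * ?I ?s - \<sigma>\<^sup>2 * ?s"
  have "(z ?t - r)\<^sup>2 - (x - r)\<^sup>2 - (\<Sum>i<Suc k. martingale_increment h i)
      - 2 * \<theta> * ?I ?t - \<sigma>\<^sup>2 * ?t = ?Q + ?P"
    by (simp add: algebra_simps)
  moreover have "4 * \<delta> * (\<bar>\<theta>\<bar> * ?t + y ?t) = 4 * \<delta> * (\<bar>\<theta>\<bar> * ?s + y ?s) + 4 * \<delta> * (\<bar>\<theta>\<bar> * h + (y ?t - y ?s))"
    by (simp add: algebra_simps)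
  moreover have "\<bar>?Q\<bar> \<le> 4 * \<delta> * (\<bar>\<theta>\<bar> * ?s + y ?s)"
    using Suc by simp
  ultimately show ?case
    using step abs_triangle_ineq[of ?Q ?P] by (simp only: add_mono order_trans)
qed

text \<open>
  The Ito formula for a single path, without a stochastic integral: the convergence of the martingale
  sums is a conclusion, forced by the convergence of all other terms of the energy identity.
\<close>

lemma energy_limit:
  assumes "0 < T"
  shows "(\<lambda>n. (z T - r)\<^sup>2 - (x - r)\<^sup>2 - (\<Sum>i<n. martingale_increment (T / real n) i))
    \<longlonglongrightarrow> 2 * \<theta> * integral {0..T} (\<lambda>u. z u - r) + \<sigma>\<^sup>2 * T"
proof -
  define L where "L = 2 * \<theta> * integral {0..T} (\<lambda>u. z u - r) + \<sigma>\<^sup>2 * T"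
  define V where "V = \<bar>\<theta>\<bar> * T + y T"
  have "y 0 \<le> y T"
    using assms by (intro mono_onD[OF mono_y]) auto
  then have "0 \<le> V"
    using y_0 assms by (simp add: V_def)
  have "\<forall>\<^sub>F n in sequentially.
      \<bar>(z T - r)\<^sup>2 - (x - r)\<^sup>2 - (\<Sum>i<n. martingale_increment (T / real n) i) - L\<bar> < \<epsilon>"
    if "0 < \<epsilon>" for \<epsilon>
  proof -
    \<comment> \<open>The summand 1 covers the case \<open>V = 0\<close>.\<close>
    define \<delta> where "\<delta> = \<epsilon> / (4 * V + 1)"
    have "0 < \<delta>" using \<open>0 \<le> V\<close> that by (simp add: \<delta>_def)
    have "4 * \<delta> * V < \<epsilon>"
      using \<open>0 \<le> V\<close> that by (simp add: \<delta>_def field_simps)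
    from grid_modulus[OF \<open>0 < \<delta>\<close> assms] eventually_gt_at_top[of 0] show ?thesis
    proof eventually_elim
      case (elim n)
      then have n: "real n * (T / real n) = T" by simp
      have "\<bar>(z T - r)\<^sup>2 - (x - r)\<^sup>2 - (\<Sum>i<n. martingale_increment (T / real n) i)
          - 2 * \<theta> * integral {0..T} (\<lambda>u. z u - r) - \<sigma>\<^sup>2 * T\<bar> \<le> 4 * \<delta> * V"
        using energy_grid[of "T / real n" \<delta> n n, unfolded n] \<open>0 < \<delta>\<close> assms elim
        by (simp add: V_def)
      then show ?case using \<open>4 * \<delta> * V < \<epsilon>\<close> by (simp add: L_def)
    qed
  qed
  then show ?thesis
    unfolding L_def[symmetric] by (auto simp: tendsto_iff dist_real_def)
qed

end

section \<open>Brownian increments\<close>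

text \<open>
  Completing the square turns the integrand into a multiple of the normal density with mean \<open>c * s\<^sup>2\<close>.
\<close>

lemma normal_exponential_moment:
  assumes "0 < s"
  shows "integrable lborel (\<lambda>x. normal_density 0 s x * exp (c * x))"
    and "(\<integral>x. normal_density 0 s x * exp (c * x) \<partial>lborel) = exp (c\<^sup>2 * s\<^sup>2 / 2)"
proof -
  have "(\<lambda>x. normal_density 0 s x * exp (c * x)) =
      (\<lambda>x. exp (c\<^sup>2 * s\<^sup>2 / 2) * normal_density (c * s\<^sup>2) s x)"
  proof
    fix x
    have "- x\<^sup>2 / (2 * s\<^sup>2) + c * x = c\<^sup>2 * s\<^sup>2 / 2 + - (x - c * s\<^sup>2)\<^sup>2 / (2 * s\<^sup>2)"
      using assms by (simp add: field_simps power2_eq_square)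
    then have "exp (- x\<^sup>2 / (2 * s\<^sup>2)) * exp (c * x)
        = exp (c\<^sup>2 * s\<^sup>2 / 2) * exp (- (x - c * s\<^sup>2)\<^sup>2 / (2 * s\<^sup>2))"
      by (simp only: exp_add[symmetric])
    then show "normal_density 0 s x * exp (c * x) = exp (c\<^sup>2 * s\<^sup>2 / 2) * normal_density (c * s\<^sup>2) s x"
      unfolding normal_density_def by (simp add: ac_simps)
  qed
  then show "integrable lborel (\<lambda>x. normal_density 0 s x * exp (c * x))"
    and "(\<integral>x. normal_density 0 s x * exp (c * x) \<partial>lborel) = exp (c\<^sup>2 * s\<^sup>2 / 2)"
    using assms by simp_all
qed

locale brownian_motion =
  fixes M :: "'a measure" and F :: "real \<Rightarrow> 'a measure" and B :: "real \<Rightarrow> 'a \<Rightarrow> real"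
  assumes bm: "standard_brownian_motion M F B"

sublocale brownian_motion \<subseteq> prob_space M
  using bm by (simp add: standard_brownian_motion_def)

context brownian_motion
begin

lemma subalgebra_F: "subalgebra M (F t)"
  using bm by (simp add: standard_brownian_motion_def)

lemma measurable_F_mono:
  assumes "s \<le> t" "X \<in> borel_measurable (F s)"
  shows "X \<in> borel_measurable (F t)"
proof -
  have "filtration (space M) F"
    using bm by (simp add: standard_brownian_motion_def)
  then have "subalgebra (F t) (F s)"
    using filtration.sets_F_mono[of "space M" F s t] filtration.space_F assms(1)
    by (fastforce simp: subalgebra_def)
  then show ?thesis using assms(2) by (rule measurable_from_subalg)
qed

lemma measurable_F_M: "X \<in> borel_measurable (F t) \<Longrightarrow> X \<in> borel_measurable M"
  using measurable_from_subalg[OF subalgebra_F] .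

lemma B_measurable: "0 \<le> t \<Longrightarrow> B t \<in> borel_measurable (F t)"
  using bm by (simp add: standard_brownian_motion_def adapted_process_def)

lemma increment_measurable:
  assumes "0 \<le> s" "s \<le> t"
  shows "(\<lambda>\<omega>. B t \<omega> - B s \<omega>) \<in> borel_measurable (F t)"
  using assms measurable_F_mono[OF assms(2) B_measurable] B_measurable[of t] by simp

lemma increment_distributed:
  assumes "0 \<le> s" "s < t"
  shows "distributed M lborel (\<lambda>\<omega>. B t \<omega> - B s \<omega>) (normal_density 0 (sqrt (t - s)))"
  using bm assms by (simp add: standard_brownian_motion_def)

lemma increment_expectation:
  fixes g :: "real \<Rightarrow> real"
  assumes "0 \<le> s" "s < t" and [measurable]: "g \<in> borel_measurable borel"
    and "integrable lborel (\<lambda>x. normal_density 0 (sqrt (t - s)) x * g x)"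
  shows "integrable M (\<lambda>\<omega>. g (B t \<omega> - B s \<omega>))"
    and "expectation (\<lambda>\<omega>. g (B t \<omega> - B s \<omega>)) = (\<integral>x. normal_density 0 (sqrt (t - s)) x * g x \<partial>lborel)"
  using distributed_integrable[OF increment_distributed[OF assms(1,2)], of g]
    distributed_integral[OF increment_distributed[OF assms(1,2)], of g] assms by auto

lemma increment_exponential_moment:
  assumes "0 \<le> s" "s < t"
  shows "integrable M (\<lambda>\<omega>. exp (c * (B t \<omega> - B s \<omega>)))"
    and "expectation (\<lambda>\<omega>. exp (c * (B t \<omega> - B s \<omega>))) = exp (c\<^sup>2 * (t - s) / 2)"
  using increment_expectation[OF assms, of "\<lambda>x. exp (c * x)"]
    normal_exponential_moment[of "sqrt (t - s)" c] assms by simp_all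

lemma increment_moments:
  assumes "0 \<le> s" "s < t"
  shows "integrable M (\<lambda>\<omega>. (B t \<omega> - B s \<omega>) ^ k)"
    and "expectation (\<lambda>\<omega>. B t \<omega> - B s \<omega>) = 0"
    and "expectation (\<lambda>\<omega>. (B t \<omega> - B s \<omega>)\<^sup>2) = t - s"
    and "expectation (\<lambda>\<omega>. (B t \<omega> - B s \<omega>) ^ 4) = 3 * (t - s)\<^sup>2"
proof -
  have pos: "0 < sqrt (t - s)" using assms by simp
  note i = integrable_normal_moment[OF pos, of 0, simplified]
  show "integrable M (\<lambda>\<omega>. (B t \<omega> - B s \<omega>) ^ k)" for k
    using increment_expectation(1)[OF assms, of "\<lambda>x. x ^ k"] i by simp
  have e: "expectation (\<lambda>\<omega>. (B t \<omega> - B s \<omega>) ^ k) =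
      (\<integral>x. normal_density 0 (sqrt (t - s)) x * x ^ k \<partial>lborel)" for k
    using increment_expectation(2)[OF assms, of "\<lambda>x. x ^ k"] i by simp
  show "expectation (\<lambda>\<omega>. B t \<omega> - B s \<omega>) = 0"
    using e[of 1] integral_normal_moment_odd[OF pos, of 0 0] by simp
  show "expectation (\<lambda>\<omega>. (B t \<omega> - B s \<omega>)\<^sup>2) = t - s"
    using e[of 2] integral_normal_moment_even[OF pos, of 0 1] assms by (simp add: fact_numeral)
  show "expectation (\<lambda>\<omega>. (B t \<omega> - B s \<omega>) ^ 4) = 3 * (t - s)\<^sup>2"
    using e[of 4] integral_normal_moment_even[OF pos, of 0 2] assms
    by (simp add: fact_numeral power2_eq_square)
qed

lemma increment_indep:
  assumes "0 \<le> s" "s < t" and X: "X \<in> borel_measurable (F s)"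
  shows "indep_var borel X borel (\<lambda>\<omega>. B t \<omega> - B s \<omega>)"
proof -
  let ?D = "\<lambda>\<omega>. B t \<omega> - B s \<omega>"
  let ?SX = "{X -` A \<inter> space M |A. A \<in> sets borel}"
  let ?SD = "{?D -` A \<inter> space M |A. A \<in> sets borel}"
  have ind: "indep_set (sets (F s)) (sets (vimage_algebra (space M) ?D borel))"
    using bm assms by (simp add: standard_brownian_motion_def)
  have "sigma_sets (space M) ?SD = sets (vimage_algebra (space M) ?D borel)"
    by (simp add: sets_vimage_algebra)
  moreover have "sigma_sets (space M) ?SX \<subseteq> sets (F s)"
  proof -
    have "space (F s) = space M"
      using subalgebra_F by (simp add: subalgebra_def)
    moreover have "?SX \<subseteq> sets (F s)"
      using measurable_sets[OF X] \<open>space (F s) = space M\<close> by auto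
    ultimately show ?thesis
      using sets.sigma_sets_subset[of ?SX "F s"] by simp
  qed
  ultimately have "indep_set (sigma_sets (space M) ?SX) (sigma_sets (space M) ?SD)"
    using ind unfolding indep_set_def
    by (elim indep_sets_mono_sets) (auto split: bool.split)
  moreover have "?D \<in> borel_measurable M"
    using measurable_F_M[OF increment_measurable] assms by simp
  ultimately show ?thesis
    unfolding indep_var_eq using measurable_F_M[OF X] by blast
qed

text \<open>
  The only form in which independence of the increments is used: a factor known at time \<open>s\<close> splits off
  from the expectation of a function of the increment after \<open>s\<close>.
\<close>

lemma expectation_mult_increment:
  fixes g :: "real \<Rightarrow> real"
  assumes "0 \<le> s" "s < t" "X \<in> borel_measurable (F s)" "integrable M X"
    and "g \<in> borel_measurable borel" "integrable M (\<lambda>\<omega>. g (B t \<omega> - B s \<omega>))"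
  shows "integrable M (\<lambda>\<omega>. X \<omega> * g (B t \<omega> - B s \<omega>))"
    and "expectation (\<lambda>\<omega>. X \<omega> * g (B t \<omega> - B s \<omega>)) =
      expectation X * expectation (\<lambda>\<omega>. g (B t \<omega> - B s \<omega>))"
proof -
  have "indep_var borel X borel (\<lambda>\<omega>. g (B t \<omega> - B s \<omega>))"
    using indep_var_compose[OF increment_indep[OF assms(1-3)] measurable_ident assms(5)]
    by (simp add: comp_def id_def)
  then show "integrable M (\<lambda>\<omega>. X \<omega> * g (B t \<omega> - B s \<omega>))"
    and "expectation (\<lambda>\<omega>. X \<omega> * g (B t \<omega> - B s \<omega>)) =
      expectation X * expectation (\<lambda>\<omega>. g (B t \<omega> - B s \<omega>))"
    using indep_var_integrable indep_var_lebesgue_integral assms by blast+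
qed

section \<open>Exponential moments of the Lindley recursion\<close>

definition drifted_lindley :: "real \<Rightarrow> real \<Rightarrow> real \<Rightarrow> nat \<Rightarrow> 'a \<Rightarrow> real" where
  "drifted_lindley \<theta> \<sigma> h k \<omega> =
    lindley (\<lambda>i. \<theta> * h + \<sigma> * (B (real (Suc i) * h) \<omega> - B (real i * h) \<omega>)) k"

lemma drifted_lindley_simps:
  "drifted_lindley \<theta> \<sigma> h 0 \<omega> = 0"
  "drifted_lindley \<theta> \<sigma> h (Suc k) \<omega> = max 0 (drifted_lindley \<theta> \<sigma> h k \<omega> +
      (\<theta> * h + \<sigma> * (B (real (Suc k) * h) \<omega> - B (real k * h) \<omega>)))"
  "0 \<le> drifted_lindley \<theta> \<sigma> h k \<omega>"
  by (simp_all add: drifted_lindley_def lindley_nonneg)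

lemma drifted_lindley_measurable:
  assumes "0 \<le> h"
  shows "drifted_lindley \<theta> \<sigma> h k \<in> borel_measurable (F (real k * h))"
proof (induction k)
  case (Suc k)
  have [measurable]: "drifted_lindley \<theta> \<sigma> h k \<in> borel_measurable (F (real (Suc k) * h))"
    using measurable_F_mono[OF _ Suc] grid_step(2)[OF assms] by blast
  have [measurable]: "(\<lambda>\<omega>. B (real (Suc k) * h) \<omega> - B (real k * h) \<omega>) \<in> borel_measurable (F (real (Suc k) * h))"
    by (intro increment_measurable grid_step[OF assms])
  show ?case
    unfolding drifted_lindley_simps(2) by measurable
qed (simp add: drifted_lindley_simps(1))

text \<open>
  The hyperbolic cosine has its minimum at 0, so that moving a negative argument to 0 decreases it.
\<close>

lemma exp_max_0_le:
  "exp (a * max 0 v) + exp (- a * max 0 v) \<le> exp (a * v) + exp (- a * v :: real)"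
proof -
  have "2 \<le> u + 1 / u" if "0 < u" for u :: real
    using that sum_squares_ge_zero[of "u - 1" 0] by (simp add: field_simps power2_eq_square)
  from this[of "exp (a * v)"] show ?thesis
    by (cases "0 \<le> v") (auto simp: exp_minus field_simps)
qed

text \<open>
  Let \<open>u\<close> be the expectation of \<open>exp (a L) + exp (- a L)\<close>. The exponent \<open>a = - \<theta> / \<sigma>\<^sup>2\<close> minimizes
  \<open>a \<theta> + a\<^sup>2 \<sigma>\<^sup>2 / 2\<close>. One step multiplies the expectation of \<open>exp (a L)\<close> by \<open>q < 1\<close> and that of
  \<open>exp (- a L)\<close> by \<open>1 / q\<^sup>3\<close>. As \<open>exp (- a L) \<le> 1\<close>, the next value of \<open>u\<close> is at most
  \<open>q u + (1 / q\<^sup>3 - q)\<close>. Both \<open>1 - q\<close> and \<open>1 / q\<^sup>3 - q\<close> are of order \<open>h\<close>, hence the fixed point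
  \<open>(1 / q\<^sup>3 - q) / (1 - q) = (1 + q + q\<^sup>2 + q\<^sup>3) / q\<^sup>3\<close> stays bounded by \<open>4 / q\<^sup>3\<close> under refinement of
  the grid. The summand 2 accounts for the initial value.
\<close>

lemma drifted_lindley_exponential_moment:
  fixes \<theta> \<sigma> h :: real
  assumes "0 < h" "\<theta> < 0" "0 < \<sigma>"
  defines "a \<equiv> - \<theta> / \<sigma>\<^sup>2" and "q \<equiv> exp (- (\<theta>\<^sup>2 / (2 * \<sigma>\<^sup>2) * h))"
  shows "integrable M (\<lambda>\<omega>. exp (a * drifted_lindley \<theta> \<sigma> h k \<omega>) + exp (- a * drifted_lindley \<theta> \<sigma> h k \<omega>)) \<and>
    expectation (\<lambda>\<omega>. exp (a * drifted_lindley \<theta> \<sigma> h k \<omega>) + exp (- a * drifted_lindley \<theta> \<sigma> h k \<omega>))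
      \<le> 2 + 4 / q ^ 3"
proof -
  let ?L = "drifted_lindley \<theta> \<sigma> h"
  let ?C = "\<lambda>v. exp (a * v) + exp (- a * v)"
  have "0 < a" using assms by (simp add: a_def field_simps)
  have q: "0 < q" "q < 1" using assms by (simp_all add: q_def)
  show "integrable M (\<lambda>\<omega>. ?C (?L k \<omega>)) \<and> expectation (\<lambda>\<omega>. ?C (?L k \<omega>)) \<le> 2 + 4 / q ^ 3"
  proof (induction k)
    case 0
    then show ?case using q by (simp add: drifted_lindley_simps(1) prob_space)
  next
    case (Suc k)
    let ?s = "real k * h" and ?t = "real (Suc k) * h"
    let ?D = "\<lambda>\<omega>. B ?t \<omega> - B ?s \<omega>"
    have h: "0 \<le> h" using assms by simp
    have st: "0 \<le> ?s" "?s < ?t" "?t - ?s = h"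
      using grid_step(1,3)[OF h, of k] \<open>0 < h\<close> by linarith+
    have meas_F [measurable]: "?L k \<in> borel_measurable (F ?s)" "?L (Suc k) \<in> borel_measurable (F ?t)"
      using drifted_lindley_measurable[OF h] by blast+
    have meas [measurable]: "?L k \<in> borel_measurable M" "?L (Suc k) \<in> borel_measurable M"
      using meas_F measurable_F_M by blast+
    have pos: "integrable M (\<lambda>\<omega>. exp (a * ?L k \<omega>))"
      by (rule Bochner_Integration.integrable_bound[OF conjunct1[OF Suc]]) auto
    have neg: "integrable M (\<lambda>\<omega>. exp (- a * ?L k \<omega>))"
      by (rule Bochner_Integration.integrable_bound[OF conjunct1[OF Suc]]) auto
    have neg_le: "expectation (\<lambda>\<omega>. exp (- a * ?L k \<omega>)) \<le> 1"
    proof -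
      have "expectation (\<lambda>\<omega>. exp (- a * ?L k \<omega>)) \<le> expectation (\<lambda>\<omega>. 1)"
        using neg \<open>0 < a\<close> drifted_lindley_simps(3) by (intro integral_mono) auto
      then show ?thesis by (simp add: prob_space)
    qed
    have factor: "integrable M (\<lambda>\<omega>. exp (c * ?L k \<omega>) * exp (c * \<sigma> * ?D \<omega>))"
      "expectation (\<lambda>\<omega>. exp (c * ?L k \<omega>) * exp (c * \<sigma> * ?D \<omega>)) =
        expectation (\<lambda>\<omega>. exp (c * ?L k \<omega>)) * exp ((c * \<sigma>)\<^sup>2 * h / 2)"
      if "integrable M (\<lambda>\<omega>. exp (c * ?L k \<omega>))" for c
      using expectation_mult_increment[OF st(1,2) _ that, of "\<lambda>u. exp (c * \<sigma> * u)"]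
        increment_exponential_moment[OF st(1,2), of "c * \<sigma>"] st(3) by simp_all
    \<comment> \<open>By the choice of \<open>a\<close>, the two exponents are \<open>- c h\<close> and \<open>3 c h\<close> with \<open>c = \<theta>\<^sup>2 / (2 \<sigma>\<^sup>2)\<close>.\<close>
    have up: "exp (a * \<theta> * h) * exp ((a * \<sigma>)\<^sup>2 * h / 2) = q"
    proof -
      have "a * \<theta> * h + (a * \<sigma>)\<^sup>2 * h / 2 = - (\<theta>\<^sup>2 / (2 * \<sigma>\<^sup>2) * h)"
        using assms by (simp add: a_def field_simps power2_eq_square)
      then show ?thesis by (simp only: exp_add[symmetric] q_def)
    qed
    have down: "exp (- a * \<theta> * h) * exp ((- a * \<sigma>)\<^sup>2 * h / 2) = 1 / q ^ 3"
    proof -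
      have "- a * \<theta> * h + (- a * \<sigma>)\<^sup>2 * h / 2 = - (3 * - (\<theta>\<^sup>2 / (2 * \<sigma>\<^sup>2) * h))"
        using assms by (simp add: a_def field_simps power2_eq_square)
      then have "exp (- a * \<theta> * h) * exp ((- a * \<sigma>)\<^sup>2 * h / 2) = exp (- (3 * - (\<theta>\<^sup>2 / (2 * \<sigma>\<^sup>2) * h)))"
        by (simp only: exp_add[symmetric])
      also have "\<dots> = 1 / exp (real 3 * - (\<theta>\<^sup>2 / (2 * \<sigma>\<^sup>2) * h))"
        by (simp add: exp_minus field_simps)
      also have "\<dots> = 1 / q ^ 3"
        unfolding exp_of_nat_mult q_def ..
      finally show ?thesis .
    qed
    define R where "R \<omega> = exp (a * \<theta> * h) * (exp (a * ?L k \<omega>) * exp (a * \<sigma> * ?D \<omega>))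
      + exp (- a * \<theta> * h) * (exp (- a * ?L k \<omega>) * exp (- a * \<sigma> * ?D \<omega>))" for \<omega>
    have R_int: "integrable M R"
      unfolding R_def using factor(1)[OF pos] factor(1)[OF neg] by simp
    \<comment> \<open>\<open>R\<close> is the value at the next step without the truncation at 0.\<close>
    have R_ge: "?C (?L (Suc k) \<omega>) \<le> R \<omega>" for \<omega>
    proof -
      have "?C (?L (Suc k) \<omega>) \<le> ?C (?L k \<omega> + (\<theta> * h + \<sigma> * ?D \<omega>))"
        unfolding drifted_lindley_simps(2) by (rule exp_max_0_le)
      also have "\<dots> = R \<omega>"
        unfolding R_def exp_add[symmetric] by (simp add: algebra_simps)
      finally show ?thesis .
    qed
    have int: "integrable M (\<lambda>\<omega>. ?C (?L (Suc k) \<omega>))"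
      using R_ge by (intro Bochner_Integration.integrable_bound[OF R_int])
        (auto intro!: AE_I2 order_trans[OF _ abs_ge_self])
    have "expectation (\<lambda>\<omega>. ?C (?L (Suc k) \<omega>)) \<le> expectation R"
      using int R_int R_ge by (intro integral_mono)
    also have "\<dots> = q * expectation (\<lambda>\<omega>. exp (a * ?L k \<omega>)) + 1 / q ^ 3 * expectation (\<lambda>\<omega>. exp (- a * ?L k \<omega>))"
    proof -
      have "expectation R =
          exp (a * \<theta> * h) * (expectation (\<lambda>\<omega>. exp (a * ?L k \<omega>)) * exp ((a * \<sigma>)\<^sup>2 * h / 2)) +
          exp (- a * \<theta> * h) * (expectation (\<lambda>\<omega>. exp (- a * ?L k \<omega>)) * exp ((- a * \<sigma>)\<^sup>2 * h / 2))"
        unfolding R_def factor(2)[OF pos, symmetric] factor(2)[OF neg, symmetric]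
        using factor(1)[OF pos] factor(1)[OF neg] by simp
      also have "exp (a * \<theta> * h) * (expectation (\<lambda>\<omega>. exp (a * ?L k \<omega>)) * exp ((a * \<sigma>)\<^sup>2 * h / 2))
          = q * expectation (\<lambda>\<omega>. exp (a * ?L k \<omega>))"
        by (simp only: up[symmetric] ac_simps)
      also have "exp (- a * \<theta> * h) * (expectation (\<lambda>\<omega>. exp (- a * ?L k \<omega>)) * exp ((- a * \<sigma>)\<^sup>2 * h / 2))
          = 1 / q ^ 3 * expectation (\<lambda>\<omega>. exp (- a * ?L k \<omega>))"
        by (simp only: down[symmetric] ac_simps)
      finally show ?thesis .
    qed
    also have "\<dots> = q * expectation (\<lambda>\<omega>. ?C (?L k \<omega>)) + (1 / q ^ 3 - q) * expectation (\<lambda>\<omega>. exp (- a * ?L k \<omega>))"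
      using pos neg by (simp add: algebra_simps)
    also have "\<dots> \<le> q * (2 + 4 / q ^ 3) + (1 / q ^ 3 - q) * 1"
    proof (intro add_mono mult_left_mono neg_le conjunct2[OF Suc])
      have "q * q ^ 3 \<le> 1" using q by (simp add: mult_le_one power_le_one)
      then show "0 \<le> 1 / q ^ 3 - q" using q by (simp add: field_simps)
    qed (use q in simp)
    also have "\<dots> \<le> 2 + 4 / q ^ 3"
    proof -
      have "1 + q + q\<^sup>2 + q ^ 3 \<le> 4"
        using q power_le_one[of q 2] power_le_one[of q 3] by simp
      then have "(1 - q) * (1 + q + q\<^sup>2 + q ^ 3) \<le> (1 - q) * 4"
        using q by (intro mult_left_mono) auto
      then have "1 - q * q ^ 3 \<le> (1 - q) * 4"
        by (simp add: algebra_simps power2_eq_square power3_eq_cube)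
      then have "(1 - q * q ^ 3) / q ^ 3 \<le> (1 - q) * 4 / q ^ 3"
        using q by (intro divide_right_mono) auto
      moreover have "(1 - q * q ^ 3) / q ^ 3 = 1 / q ^ 3 - q"
        using q by (simp add: diff_divide_distrib)
      moreover have "(1 - q) * 4 / q ^ 3 = 4 / q ^ 3 - q * (4 / q ^ 3)"
        by (simp add: diff_divide_distrib left_diff_distrib)
      ultimately show ?thesis using q by (simp add: distrib_left)
    qed
    finally show ?case using int by blast
  qed
qed

end

section \<open>The fourth moment of reflected Brownian motion\<close>

locale reflected_brownian = brownian_motion M F B
  for M :: "'a measure" and F B +
  fixes \<theta> \<sigma> r x :: real and Z Y :: "real \<Rightarrow> 'a \<Rightarrow> real"
  assumes drift_neg: "\<theta> < 0" and \<sigma>_pos: "0 < \<sigma>" and start_above: "r \<le> x"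
    and rbm: "reflected_brownian_motion M F B \<theta> \<sigma> r x Z Y"
begin

text \<open>
  The link between the two parts: everything about a single path applies to almost every \<open>\<omega>\<close>.
\<close>

lemma AE_reflected_path:
  "AE \<omega> in M. reflected_path \<theta> \<sigma> r x (\<lambda>t. B t \<omega>) (\<lambda>t. Z t \<omega>) (\<lambda>t. Y t \<omega>)"
proof -
  have "AE \<omega> in M. B 0 \<omega> = 0 \<and> continuous_on {0..} (\<lambda>t. B t \<omega>)"
    using bm by (simp add: standard_brownian_motion_def)
  moreover have "AE \<omega> in M.
        continuous_on {0..} (\<lambda>t. Z t \<omega>) \<and> continuous_on {0..} (\<lambda>t. Y t \<omega>) \<and>
        (\<forall>t\<ge>0. Z t \<omega> = x + \<theta> * t + \<sigma> * B t \<omega> + Y t \<omega> \<and> Z t \<omega> \<ge> r) \<and>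
        mono_on {0..} (\<lambda>t. Y t \<omega>) \<and> Y 0 \<omega> = 0 \<and>
        (\<forall>t\<ge>0. (\<integral>\<^sup>+ u\<in>{0..t}. indicator {u. Z u \<omega> > r} u
                  \<partial>interval_measure (\<lambda>s. Y (max 0 s) \<omega>)) = 0)"
    using rbm by (simp add: reflected_brownian_motion_def)
  ultimately show ?thesis
    by eventually_elim (unfold_locales; blast)
qed

lemma Z_measurable: "0 \<le> t \<Longrightarrow> Z t \<in> borel_measurable (F t)"
  using rbm by (simp add: reflected_brownian_motion_def adapted_process_def)

abbreviation W :: "real \<Rightarrow> 'a \<Rightarrow> real" where "W t \<omega> \<equiv> Z t \<omega> - r"

text \<open>
  The subtracted 1 absorbs the oscillation of the path over one step, which is eventually at most 1; so
  the excess is eventually dominated by the Lindley recursion itself.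
\<close>

definition excess :: "real \<Rightarrow> 'a \<Rightarrow> real" where
  "excess t \<omega> = max 0 (W t \<omega> - (x - r) - 1)"

text \<open>
  On the grid of \<open>n\<close> steps up to time \<open>t\<close>, the bound for the Lindley recursion involves \<open>1 / q\<^sup>3\<close>, which
  is at most \<open>exp 3\<close> once the mesh is fine enough. Fatou's lemma then removes the grid. The result does
  not depend on \<open>t\<close>, which is the stability of the reflected process under negative drift.
\<close>

lemma excess_exponential_moment:
  assumes "0 \<le> t"
  shows "(\<integral>\<^sup>+\<omega>. ennreal (exp (- \<theta> / \<sigma>\<^sup>2 * excess t \<omega>)) \<partial>M) \<le> ennreal (2 + 4 * exp 3)"
proof (cases "t = 0")
  case True
  have "AE \<omega> in M. ennreal (exp (- \<theta> / \<sigma>\<^sup>2 * excess t \<omega>)) = 1"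
    using AE_reflected_path
    by eventually_elim (auto simp: True excess_def dest: reflected_path.z_0)
  then have "(\<integral>\<^sup>+\<omega>. ennreal (exp (- \<theta> / \<sigma>\<^sup>2 * excess t \<omega>)) \<partial>M) = (\<integral>\<^sup>+\<omega>. 1 \<partial>M)"
    by (rule nn_integral_cong_AE)
  also have "\<dots> = ennreal 1" by (simp add: emeasure_space_1)
  also have "\<dots> \<le> ennreal (2 + 4 * exp 3)"
    by (intro ennreal_leI) (simp add: add_increasing2)
  finally show ?thesis .
next
  case False
  then have "0 < t" using assms by simp
  define a where "a = - \<theta> / \<sigma>\<^sup>2"
  define c where "c = \<theta>\<^sup>2 / (2 * \<sigma>\<^sup>2)"
  have "0 < a" using drift_neg \<sigma>_pos by (simp add: a_def field_simps)
  let ?L = "\<lambda>n. drifted_lindley \<theta> \<sigma> (t / real n) n"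
  let ?u = "\<lambda>n \<omega>. ennreal (exp (a * ?L n \<omega>) + exp (- a * ?L n \<omega>))"
  have meas [measurable]: "?L n \<in> borel_measurable M" for n
    using measurable_F_M[OF drifted_lindley_measurable] \<open>0 < t\<close> by simp
  have "AE \<omega> in M. ennreal (exp (a * excess t \<omega>)) \<le> liminf (\<lambda>n. ?u n \<omega>)"
    using AE_reflected_path
  proof eventually_elim
    case (elim \<omega>)
    interpret reflected_path \<theta> \<sigma> r x "\<lambda>t. B t \<omega>" "\<lambda>t. Z t \<omega>" "\<lambda>t. Y t \<omega>" by fact
    have "\<forall>\<^sub>F n in sequentially. ennreal (exp (a * excess t \<omega>)) \<le> ?u n \<omega>"
      using grid_modulus[OF zero_less_one \<open>0 < t\<close>] eventually_gt_at_top[of 0]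
    proof eventually_elim
      case (elim n)
      then have n: "real n * (t / real n) = t" by simp
      have "W t \<omega> \<le> (x - r) + 1 + ?L n \<omega>"
        unfolding drifted_lindley_def
        using below_lindley[of "t / real n" 1 n n, unfolded n] elim \<open>0 < t\<close> start_above by simp
      then have "excess t \<omega> \<le> ?L n \<omega>"
        using drifted_lindley_simps(3) by (simp add: excess_def)
      then have "exp (a * excess t \<omega>) \<le> exp (a * ?L n \<omega>)"
        using \<open>0 < a\<close> by simp
      then show ?case by (intro ennreal_leI) (simp add: add_increasing2)
    qed
    then show ?case by (intro Liminf_bounded)
  qed
  then have "(\<integral>\<^sup>+\<omega>. ennreal (exp (a * excess t \<omega>)) \<partial>M) \<le> (\<integral>\<^sup>+\<omega>. liminf (\<lambda>n. ?u n \<omega>) \<partial>M)"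
    by (rule nn_integral_mono_AE)
  also have "\<dots> \<le> liminf (\<lambda>n. \<integral>\<^sup>+\<omega>. ?u n \<omega> \<partial>M)"
    by (rule nn_integral_liminf) measurable
  also have "\<dots> \<le> liminf (\<lambda>n. ennreal (2 + 4 * exp 3))"
  proof (rule Liminf_mono)
    have "(\<lambda>n. c * t / real n) \<longlonglongrightarrow> 0"
      by (rule lim_const_over_n)
    then have "\<forall>\<^sub>F n in sequentially. c * t / real n < 1"
      by (rule order_tendstoD) simp
    then show "\<forall>\<^sub>F n in sequentially. (\<integral>\<^sup>+\<omega>. ?u n \<omega> \<partial>M) \<le> ennreal (2 + 4 * exp 3)"
      using eventually_gt_at_top[of 0]
    proof eventually_elim
      case (elim n)
      define q where "q = exp (- (c * (t / real n)))"
      have "0 < t / real n" using \<open>0 < t\<close> elim by simp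
      note m = drifted_lindley_exponential_moment[OF this drift_neg \<sigma>_pos, of n,
          folded a_def c_def q_def]
      have "1 / q ^ 3 = exp (3 * (c * (t / real n)))"
        using exp_of_nat_mult[of 3 "c * (t / real n)"] by (simp add: q_def exp_minus inverse_eq_divide power_one_over)
      also have "\<dots> \<le> exp 3"
        using elim(1) unfolding exp_le_cancel_iff times_divide_eq_right by linarith
      finally have "2 + 4 / q ^ 3 \<le> 2 + 4 * exp 3" by simp
      moreover have "(\<integral>\<^sup>+\<omega>. ?u n \<omega> \<partial>M) = ennreal (expectation (\<lambda>\<omega>. exp (a * ?L n \<omega>) + exp (- a * ?L n \<omega>)))"
        using m by (intro nn_integral_eq_integral) (auto simp: add_nonneg_nonneg)
      ultimately show ?case
        using order_trans[OF conjunct2[OF m]] by (simp only: ennreal_leI)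
    qed
  qed
  also have "\<dots> = ennreal (2 + 4 * exp 3)"
    by (simp add: Liminf_const)
  finally show ?thesis unfolding a_def .
qed

end

lemma power4_le_exp: "0 \<le> v \<Longrightarrow> v ^ 4 \<le> 256 * exp (v :: real)"
proof -
  assume "0 \<le> v"
  have "(v / 4) ^ 4 \<le> exp (v / 4) ^ 4"
  proof (rule power_mono)
    show "v / 4 \<le> exp (v / 4)"
      using exp_ge_add_one_self[of "v / 4"] by linarith
  qed (use \<open>0 \<le> v\<close> in simp)
  also have "\<dots> = exp v" by (simp flip: exp_of_nat_mult)
  finally show ?thesis by (simp add: power_divide)
qed

lemma power4_sum3_le: "(u + v + w :: real) ^ 4 \<le> 27 * (u ^ 4 + v ^ 4 + w ^ 4)"
proof -
  have sq: "(a + b + c)\<^sup>2 \<le> 3 * (a\<^sup>2 + b\<^sup>2 + c\<^sup>2)" for a b c :: real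
    using sum_squares_ge_zero[of "a - b" "a - c"] zero_le_power2[of "b - c"]
    by (simp add: power2_eq_square algebra_simps)
  have "(u + v + w) ^ 4 = ((u + v + w)\<^sup>2)\<^sup>2" by (simp flip: power_mult)
  also have "\<dots> \<le> (3 * (u\<^sup>2 + v\<^sup>2 + w\<^sup>2))\<^sup>2"
    by (rule power_mono[OF sq]) simp
  also have "\<dots> = 9 * (u\<^sup>2 + v\<^sup>2 + w\<^sup>2)\<^sup>2"
    unfolding power_mult_distrib by simp
  also have "\<dots> \<le> 9 * (3 * ((u\<^sup>2)\<^sup>2 + (v\<^sup>2)\<^sup>2 + (w\<^sup>2)\<^sup>2))"
    using sq[of "u\<^sup>2" "v\<^sup>2" "w\<^sup>2"] by simp
  finally show ?thesis by (simp flip: power_mult)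
qed

text \<open>
  The factors 27 and 256 are those of \<open>power4_sum3_le\<close> and \<open>power4_le_exp\<close>, and \<open>2 + 4 * exp 3\<close> is the
  bound of \<open>excess_exponential_moment\<close>.
\<close>

definition moment_constant :: "real \<Rightarrow> real \<Rightarrow> real" where
  "moment_constant \<theta> \<sigma> = 27 + 27 * (256 / (- \<theta> / \<sigma>\<^sup>2) ^ 4) * (2 + 4 * exp 3)"

lemma moment_constant_ge: "27 \<le> moment_constant \<theta> \<sigma>"
  unfolding moment_constant_def by (simp add: zero_le_even_power add_nonneg_nonneg)

context reflected_brownian
begin

lemma W_fourth_moment_nn:
  assumes "0 \<le> t"
  shows "(\<integral>\<^sup>+\<omega>. ennreal ((W t \<omega>) ^ 4) \<partial>M) \<le> ennreal (moment_constant \<theta> \<sigma> * (1 + (x - r) ^ 4))"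
proof -
  define a where "a = - \<theta> / \<sigma>\<^sup>2"
  define w where "w = x - r"
  have "0 < a" using drift_neg \<sigma>_pos by (simp add: a_def field_simps)
  have Z_meas [measurable]: "Z t \<in> borel_measurable M"
    using measurable_F_M[OF Z_measurable] assms by simp
  have [measurable]: "excess t \<in> borel_measurable M"
    unfolding excess_def by measurable
  define K where "K = 27 * (256 / a ^ 4)"
  have "0 < K" using \<open>0 < a\<close> by (simp add: K_def)
  have "AE \<omega> in M. ennreal ((W t \<omega>) ^ 4) \<le>
      ennreal (27 * (1 + w ^ 4)) + ennreal K * ennreal (exp (a * excess t \<omega>))"
    using AE_reflected_path
  proof eventually_elim
    case (elim \<omega>)
    interpret reflected_path \<theta> \<sigma> r x "\<lambda>t. B t \<omega>" "\<lambda>t. Z t \<omega>" "\<lambda>t. Y t \<omega>" by fact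
    have "0 \<le> excess t \<omega>" by (simp add: excess_def)
    have "(W t \<omega>) ^ 4 \<le> (w + 1 + excess t \<omega>) ^ 4"
      using above[OF assms] by (intro power_mono) (auto simp: excess_def w_def)
    also have "\<dots> \<le> 27 * (w ^ 4 + 1 ^ 4 + excess t \<omega> ^ 4)"
      by (rule power4_sum3_le)
    also have "excess t \<omega> ^ 4 \<le> 256 / a ^ 4 * exp (a * excess t \<omega>)"
      using power4_le_exp[of "a * excess t \<omega>"] \<open>0 < a\<close> \<open>0 \<le> excess t \<omega>\<close>
      by (simp add: power_mult_distrib field_simps)
    finally have "(W t \<omega>) ^ 4 \<le> 27 * (1 + w ^ 4) + K * exp (a * excess t \<omega>)"
      by (simp add: K_def algebra_simps)
    then show ?case
      using \<open>0 < K\<close> by (simp add: ennreal_leI flip: ennreal_plus ennreal_mult)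
  qed
  then have "(\<integral>\<^sup>+\<omega>. ennreal ((W t \<omega>) ^ 4) \<partial>M) \<le>
      (\<integral>\<^sup>+\<omega>. ennreal (27 * (1 + w ^ 4)) + ennreal K * ennreal (exp (a * excess t \<omega>)) \<partial>M)"
    by (rule nn_integral_mono_AE)
  also have "\<dots> = ennreal (27 * (1 + w ^ 4)) + ennreal K * (\<integral>\<^sup>+\<omega>. ennreal (exp (a * excess t \<omega>)) \<partial>M)"
    by (simp add: nn_integral_add nn_integral_cmult emeasure_space_1)
  also have "\<dots> \<le> ennreal (27 * (1 + w ^ 4)) + ennreal K * ennreal (2 + 4 * exp 3)"
    using excess_exponential_moment[OF assms] by (intro add_left_mono mult_left_mono) (auto simp: a_def)
  also have "\<dots> = ennreal (27 * (1 + w ^ 4) + K * (2 + 4 * exp 3))"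
    using \<open>0 < K\<close> by (simp add: add_nonneg_nonneg flip: ennreal_plus ennreal_mult)
  also have "\<dots> \<le> ennreal (moment_constant \<theta> \<sigma> * (1 + w ^ 4))"
  proof (rule ennreal_leI)
    have "K * (2 + 4 * exp 3) * 1 \<le> K * (2 + 4 * exp 3) * (1 + w ^ 4)"
      using \<open>0 < K\<close> by (intro mult_left_mono) (auto simp: add_nonneg_nonneg)
    then show "27 * (1 + w ^ 4) + K * (2 + 4 * exp 3) \<le> moment_constant \<theta> \<sigma> * (1 + w ^ 4)"
      by (simp add: moment_constant_def K_def a_def ring_distribs)
  qed
  finally show ?thesis unfolding w_def .
qed

lemma W_fourth_moment:
  assumes "0 \<le> t"
  shows "integrable M (\<lambda>\<omega>. (W t \<omega>) ^ 4)"
    and "expectation (\<lambda>\<omega>. (W t \<omega>) ^ 4) \<le> moment_constant \<theta> \<sigma> * (1 + (x - r) ^ 4)"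
proof -
  have [measurable]: "Z t \<in> borel_measurable M"
    using measurable_F_M[OF Z_measurable] assms by simp
  show int: "integrable M (\<lambda>\<omega>. (W t \<omega>) ^ 4)"
    using W_fourth_moment_nn[OF assms] by (intro integrableI_bounded) (auto simp: le_less_trans)
  have "ennreal (expectation (\<lambda>\<omega>. (W t \<omega>) ^ 4)) \<le> ennreal (moment_constant \<theta> \<sigma> * (1 + (x - r) ^ 4))"
    using W_fourth_moment_nn[OF assms] nn_integral_eq_integral[OF int] by simp
  then show "expectation (\<lambda>\<omega>. (W t \<omega>) ^ 4) \<le> moment_constant \<theta> \<sigma> * (1 + (x - r) ^ 4)"
    using moment_constant_ge[of \<theta> \<sigma>] by (subst (asm) ennreal_le_iff) (auto intro!: mult_nonneg_nonneg add_nonneg_nonneg)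
qed

lemma W_second_moment:
  assumes "0 \<le> t"
  shows "integrable M (\<lambda>\<omega>. (W t \<omega>)\<^sup>2)"
    and "expectation (\<lambda>\<omega>. (W t \<omega>)\<^sup>2) \<le> 1 + moment_constant \<theta> \<sigma> * (1 + (x - r) ^ 4)"
proof -
  have [measurable]: "Z t \<in> borel_measurable M"
    using measurable_F_M[OF Z_measurable] assms by simp
  have le: "v\<^sup>2 \<le> 1 + v ^ 4" for v :: real
  proof -
    have "0 \<le> (v\<^sup>2 - 1)\<^sup>2" "0 \<le> v\<^sup>2" by simp_all
    then have "2 * v\<^sup>2 \<le> 1 + (v\<^sup>2)\<^sup>2" by (simp add: power2_diff)
    then have "v\<^sup>2 \<le> 1 + (v\<^sup>2)\<^sup>2" using \<open>0 \<le> v\<^sup>2\<close> by linarith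
    then show ?thesis by (simp flip: power_mult)
  qed
  have int: "integrable M (\<lambda>\<omega>. 1 + (W t \<omega>) ^ 4)"
    using W_fourth_moment(1)[OF assms] by simp
  show int2: "integrable M (\<lambda>\<omega>. (W t \<omega>)\<^sup>2)"
    using le by (intro Bochner_Integration.integrable_bound[OF int]) (auto intro!: AE_I2 order_trans[OF _ abs_ge_self])
  have "expectation (\<lambda>\<omega>. (W t \<omega>)\<^sup>2) \<le> expectation (\<lambda>\<omega>. 1 + (W t \<omega>) ^ 4)"
    using int int2 le by (intro integral_mono)
  also have "\<dots> = 1 + expectation (\<lambda>\<omega>. (W t \<omega>) ^ 4)"
    using W_fourth_moment(1)[OF assms] by (simp add: prob_space)
  finally show "expectation (\<lambda>\<omega>. (W t \<omega>)\<^sup>2) \<le> 1 + moment_constant \<theta> \<sigma> * (1 + (x - r) ^ 4)"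
    using W_fourth_moment(2)[OF assms] by simp
qed

end

section \<open>Orthogonality of the discrete martingale increments\<close>

context reflected_brownian
begin

definition martingale_sum :: "real \<Rightarrow> nat \<Rightarrow> 'a \<Rightarrow> real" where
  "martingale_sum h k \<omega> = (\<Sum>i<k.
    2 * \<sigma> * W (real i * h) \<omega> * (B (real (Suc i) * h) \<omega> - B (real i * h) \<omega>)
    + \<sigma>\<^sup>2 * ((B (real (Suc i) * h) \<omega> - B (real i * h) \<omega>)\<^sup>2 - h))"

lemma martingale_sum_measurable:
  assumes "0 \<le> h"
  shows "martingale_sum h k \<in> borel_measurable (F (real k * h))"
proof (induction k)
  case 0
  then show ?case by (simp add: martingale_sum_def)
next
  case (Suc k)
  note st = grid_step(1,2)[OF assms, of k]
  define D where "D \<omega> = B (real (Suc k) * h) \<omega> - B (real k * h) \<omega>" for \<omega>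
  have [measurable]: "martingale_sum h k \<in> borel_measurable (F (real (Suc k) * h))"
    "Z (real k * h) \<in> borel_measurable (F (real (Suc k) * h))"
    "D \<in> borel_measurable (F (real (Suc k) * h))"
    using measurable_F_mono[OF st(2) Suc] measurable_F_mono[OF st(2) Z_measurable[OF st(1)]]
      increment_measurable[OF st] unfolding D_def by blast+
  have "martingale_sum h (Suc k) = (\<lambda>\<omega>. martingale_sum h k \<omega> +
    (2 * \<sigma> * W (real k * h) \<omega> * D \<omega> + \<sigma>\<^sup>2 * ((D \<omega>)\<^sup>2 - h)))"
    by (simp add: martingale_sum_def D_def fun_eq_iff)
  also have "\<dots> \<in> borel_measurable (F (real (Suc k) * h))"
    by measurable
  finally show ?case .
qed

text \<open>
  The discrete counterpart of the Ito isometry. Conditionally on the past, \<open>\<Delta>B\<close> and \<open>(\<Delta>B)\<^sup>2 - h\<close> have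
  mean 0, so that the cross terms with the partial sum vanish; the two parts of a single increment are
  separated by \<open>(p + q)\<^sup>2 \<le> 2 p\<^sup>2 + 2 q\<^sup>2\<close>. The term with \<open>h\<^sup>2\<close> is due to the quadratic variation.
\<close>

lemma martingale_sum_second_moment:
  assumes "0 < h"
  defines "A \<equiv> 1 + moment_constant \<theta> \<sigma> * (1 + (x - r) ^ 4)"
  shows "integrable M (\<lambda>\<omega>. (martingale_sum h k \<omega>)\<^sup>2) \<and>
    expectation (\<lambda>\<omega>. (martingale_sum h k \<omega>)\<^sup>2) \<le> real k * (8 * \<sigma>\<^sup>2 * A * h + 4 * \<sigma> ^ 4 * h\<^sup>2)"
proof (induction k)
  case 0
  then show ?case by (simp add: martingale_sum_def)
next
  case (Suc k)
  let ?s = "real k * h" and ?t = "real (Suc k) * h"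
  let ?D = "\<lambda>\<omega>. B ?t \<omega> - B ?s \<omega>"
  let ?S = "martingale_sum h k"
  have h: "0 \<le> h" using assms by simp
  have st: "0 \<le> ?s" "?s < ?t" "?t - ?s = h"
    using grid_step(1,3)[OF h, of k] \<open>0 < h\<close> by linarith+
  have meas_F [measurable]: "?S \<in> borel_measurable (F ?s)" "Z ?s \<in> borel_measurable (F ?s)"
    using martingale_sum_measurable[OF h] Z_measurable[OF st(1)] by blast+
  have meas [measurable]: "?S \<in> borel_measurable M" "Z ?s \<in> borel_measurable M"
    "martingale_sum h (Suc k) \<in> borel_measurable M"
    using meas_F martingale_sum_measurable[OF h] measurable_F_M by blast+
  note S2 = conjunct1[OF Suc] and W2 = W_second_moment[OF st(1)]
  have S_int: "integrable M ?S"
    using square_integrable_imp_integrable[OF meas(1) S2] .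
  have SW_int: "integrable M (\<lambda>\<omega>. ?S \<omega> * W ?s \<omega>)"
  proof (rule Bochner_Integration.integrable_bound)
    show "integrable M (\<lambda>\<omega>. (?S \<omega>)\<^sup>2 + (W ?s \<omega>)\<^sup>2)" using S2 W2(1) by simp
    have "\<bar>u * v\<bar> \<le> u\<^sup>2 + v\<^sup>2" for u v :: real
      using sum_squares_bound[of "\<bar>u\<bar>" "\<bar>v\<bar>"] abs_ge_zero[of "u * v"]
      unfolding abs_mult power2_abs by linarith
    then show "AE \<omega> in M. norm (?S \<omega> * W ?s \<omega>) \<le> norm ((?S \<omega>)\<^sup>2 + (W ?s \<omega>)\<^sup>2)"
      by simp
  qed measurable
  have D_int: "integrable M ?D" "integrable M (\<lambda>\<omega>. (?D \<omega>)\<^sup>2)" "integrable M (\<lambda>\<omega>. (?D \<omega>) ^ 4)"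
    using increment_moments(1)[OF st(1,2), of 1] increment_moments(1)[OF st(1,2), of 2]
      increment_moments(1)[OF st(1,2), of 4] by simp_all
  note D_mom = increment_moments(2-4)[OF st(1,2), unfolded st(3)]
  have sq: "(u\<^sup>2 - h)\<^sup>2 = u ^ 4 - 2 * h * u\<^sup>2 + h\<^sup>2" for u
    by (simp add: power2_diff algebra_simps flip: power_mult)
  have SW_meas: "(\<lambda>\<omega>. ?S \<omega> * W ?s \<omega>) \<in> borel_measurable (F ?s)"
    and W2_meas: "(\<lambda>\<omega>. (W ?s \<omega>)\<^sup>2) \<in> borel_measurable (F ?s)"
    by measurable
  have var_int: "integrable M (\<lambda>\<omega>. ((?D \<omega>)\<^sup>2 - h)\<^sup>2)"
    unfolding sq using D_int by simp
  have var: "expectation (\<lambda>\<omega>. ((?D \<omega>)\<^sup>2 - h)\<^sup>2) = 2 * h\<^sup>2"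
  proof -
    have "expectation (\<lambda>\<omega>. ((?D \<omega>)\<^sup>2 - h)\<^sup>2) =
        expectation (\<lambda>\<omega>. (?D \<omega>) ^ 4) - 2 * h * expectation (\<lambda>\<omega>. (?D \<omega>)\<^sup>2) + h\<^sup>2"
      unfolding sq using D_int by (simp add: prob_space)
    also have "\<dots> = 2 * h\<^sup>2"
      unfolding D_mom by (simp add: power2_eq_square)
    finally show ?thesis .
  qed
  have cross1: "integrable M (\<lambda>\<omega>. (?S \<omega> * W ?s \<omega>) * ?D \<omega>)"
    "expectation (\<lambda>\<omega>. (?S \<omega> * W ?s \<omega>) * ?D \<omega>) = 0"
    using expectation_mult_increment[OF st(1,2) SW_meas SW_int _ D_int(1)] D_mom(1) by auto
  have "expectation (\<lambda>\<omega>. (?D \<omega>)\<^sup>2 - h) = 0"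
    using D_int(2) D_mom(2) by (simp add: prob_space)
  then have cross2: "integrable M (\<lambda>\<omega>. ?S \<omega> * ((?D \<omega>)\<^sup>2 - h))"
    "expectation (\<lambda>\<omega>. ?S \<omega> * ((?D \<omega>)\<^sup>2 - h)) = 0"
    using expectation_mult_increment[OF st(1,2) meas_F(1) S_int, of "\<lambda>u. u\<^sup>2 - h"] D_int(2) by auto
  have diag: "integrable M (\<lambda>\<omega>. (W ?s \<omega>)\<^sup>2 * (?D \<omega>)\<^sup>2)"
    "expectation (\<lambda>\<omega>. (W ?s \<omega>)\<^sup>2 * (?D \<omega>)\<^sup>2) = expectation (\<lambda>\<omega>. (W ?s \<omega>)\<^sup>2) * h"
    using expectation_mult_increment[OF st(1,2) W2_meas W2(1), of "\<lambda>u. u\<^sup>2"] D_int(2) D_mom(2) by auto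
  define R where "R \<omega> = (?S \<omega>)\<^sup>2 + 4 * \<sigma> * ((?S \<omega> * W ?s \<omega>) * ?D \<omega>)
      + 2 * \<sigma>\<^sup>2 * (?S \<omega> * ((?D \<omega>)\<^sup>2 - h))
      + 8 * \<sigma>\<^sup>2 * ((W ?s \<omega>)\<^sup>2 * (?D \<omega>)\<^sup>2) + 2 * \<sigma> ^ 4 * ((?D \<omega>)\<^sup>2 - h)\<^sup>2" for \<omega>
  have R_int: "integrable M R"
    unfolding R_def using S2 cross1(1) cross2(1) diag(1) var_int
    by (intro Bochner_Integration.integrable_add integrable_mult_right)
  have R_ge: "(martingale_sum h (Suc k) \<omega>)\<^sup>2 \<le> R \<omega>" for \<omega>
  proof -
    let ?p = "2 * \<sigma> * W ?s \<omega> * ?D \<omega>" and ?q = "\<sigma>\<^sup>2 * ((?D \<omega>)\<^sup>2 - h)"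
    have "(martingale_sum h (Suc k) \<omega>)\<^sup>2 = (?S \<omega> + (?p + ?q))\<^sup>2"
      by (simp add: martingale_sum_def)
    also have "\<dots> = (?S \<omega>)\<^sup>2 + 2 * ?S \<omega> * (?p + ?q) + (?p + ?q)\<^sup>2"
      by (rule power2_sum[THEN trans]) simp
    also have "(?p + ?q)\<^sup>2 \<le> 2 * ?p\<^sup>2 + 2 * ?q\<^sup>2"
      using sum_squares_bound[of ?p ?q] by (simp add: power2_sum)
    also have "(?S \<omega>)\<^sup>2 + 2 * ?S \<omega> * (?p + ?q) + (2 * ?p\<^sup>2 + 2 * ?q\<^sup>2) = R \<omega>"
      unfolding R_def power_mult_distrib by (simp add: algebra_simps flip: power_mult)
    finally show ?thesis by simp
  qed
  have int: "integrable M (\<lambda>\<omega>. (martingale_sum h (Suc k) \<omega>)\<^sup>2)"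
    using R_ge by (intro Bochner_Integration.integrable_bound[OF R_int])
      (auto intro!: AE_I2 order_trans[OF _ abs_ge_self])
  have "expectation (\<lambda>\<omega>. (martingale_sum h (Suc k) \<omega>)\<^sup>2) \<le> expectation R"
    using int R_int R_ge by (intro integral_mono)
  also have "\<dots> = expectation (\<lambda>\<omega>. (?S \<omega>)\<^sup>2) + 8 * \<sigma>\<^sup>2 * (expectation (\<lambda>\<omega>. (W ?s \<omega>)\<^sup>2) * h) + 2 * \<sigma> ^ 4 * (2 * h\<^sup>2)"
    unfolding R_def diag(2)[symmetric] var[symmetric]
    using S2 cross1 cross2 diag(1) var_int by simp
  also have "\<dots> \<le> real k * (8 * \<sigma>\<^sup>2 * A * h + 4 * \<sigma> ^ 4 * h\<^sup>2) + 8 * \<sigma>\<^sup>2 * (A * h) + 2 * \<sigma> ^ 4 * (2 * h\<^sup>2)"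
    using conjunct2[OF Suc] W2(2) h
    by (intro add_mono mult_left_mono mult_right_mono order_refl) (auto simp: A_def)
  also have "\<dots> = real (Suc k) * (8 * \<sigma>\<^sup>2 * A * h + 4 * \<sigma> ^ 4 * h\<^sup>2)"
    by (simp add: algebra_simps)
  finally show ?case using int by blast
qed

section \<open>The time average\<close>

text \<open>
  Fatou's lemma along the grids with \<open>n\<close> steps: each discrete energy is measurable and its second moment
  is controlled by the fourth moment of \<open>W T\<close> and the martingale sum. The factor \<open>c\<close> stands inside the
  integral so that no measurability in \<open>\<omega>\<close> of the time integral has to be established.
\<close>

lemma integral_second_moment:
  assumes "1 \<le> T" "0 \<le> c"
  defines "A \<equiv> 1 + moment_constant \<theta> \<sigma> * (1 + (x - r) ^ 4)"
  shows "(\<integral>\<^sup>+\<omega>. ennreal (c * (2 * \<theta> * integral {0..T} (\<lambda>t. W t \<omega>) + \<sigma>\<^sup>2 * T)\<^sup>2) \<partial>M)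
    \<le> ennreal (c * (3 * (2 * A + T * (8 * \<sigma>\<^sup>2 * A) + 4 * \<sigma> ^ 4 * T)))"
proof -
  have "0 < T" using assms by simp
  define w where "w = x - r"
  define E where "E n \<omega> = (W T \<omega>)\<^sup>2 - w\<^sup>2 - martingale_sum (T / real n) n \<omega>" for n \<omega>
  have Z_meas [measurable]: "Z T \<in> borel_measurable M"
    using measurable_F_M[OF Z_measurable] \<open>0 < T\<close> by simp
  have S_meas [measurable]: "martingale_sum (T / real n) k \<in> borel_measurable M" for n k
    using measurable_F_M[OF martingale_sum_measurable] \<open>0 < T\<close> by simp
  have E_meas [measurable]: "E n \<in> borel_measurable M" for n
    unfolding E_def by measurable
  have "AE \<omega> in M. ennreal (c * (2 * \<theta> * integral {0..T} (\<lambda>t. W t \<omega>) + \<sigma>\<^sup>2 * T)\<^sup>2)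
      = liminf (\<lambda>n. ennreal (c * (E n \<omega>)\<^sup>2))"
    using AE_reflected_path
  proof eventually_elim
    case (elim \<omega>)
    interpret reflected_path \<theta> \<sigma> r x "\<lambda>t. B t \<omega>" "\<lambda>t. Z t \<omega>" "\<lambda>t. Y t \<omega>" by fact
    have "(\<lambda>n. E n \<omega>) \<longlonglongrightarrow> 2 * \<theta> * integral {0..T} (\<lambda>t. W t \<omega>) + \<sigma>\<^sup>2 * T"
      using energy_limit[OF \<open>0 < T\<close>]
      by (simp add: E_def w_def martingale_sum_def martingale_increment_def)
    then have "(\<lambda>n. ennreal (c * (E n \<omega>)\<^sup>2)) \<longlonglongrightarrow> ennreal (c * (2 * \<theta> * integral {0..T} (\<lambda>t. W t \<omega>) + \<sigma>\<^sup>2 * T)\<^sup>2)"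
      by (intro tendsto_ennrealI tendsto_mult_left tendsto_power)
    then show ?case by (intro lim_imp_Liminf[symmetric]) auto
  qed
  then have "(\<integral>\<^sup>+\<omega>. ennreal (c * (2 * \<theta> * integral {0..T} (\<lambda>t. W t \<omega>) + \<sigma>\<^sup>2 * T)\<^sup>2) \<partial>M)
      = (\<integral>\<^sup>+\<omega>. liminf (\<lambda>n. ennreal (c * (E n \<omega>)\<^sup>2)) \<partial>M)"
    by (rule nn_integral_cong_AE)
  also have "\<dots> \<le> liminf (\<lambda>n. \<integral>\<^sup>+\<omega>. ennreal (c * (E n \<omega>)\<^sup>2) \<partial>M)"
    by (rule nn_integral_liminf) measurable
  also have "\<dots> \<le> liminf (\<lambda>n. ennreal (c * (3 * (2 * A + T * (8 * \<sigma>\<^sup>2 * A) + 4 * \<sigma> ^ 4 * T))))"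
  proof (rule Liminf_mono)
    have "\<forall>\<^sub>F n in sequentially. T / real n < 1"
      by (rule order_tendstoD[OF lim_const_over_n]) simp
    then show "\<forall>\<^sub>F n in sequentially. (\<integral>\<^sup>+\<omega>. ennreal (c * (E n \<omega>)\<^sup>2) \<partial>M)
        \<le> ennreal (c * (3 * (2 * A + T * (8 * \<sigma>\<^sup>2 * A) + 4 * \<sigma> ^ 4 * T)))"
      using eventually_gt_at_top[of 0]
    proof eventually_elim
      case (elim n)
      define h where "h = T / real n"
      have h: "0 < h" "h \<le> 1" "real n * h = T"
        using elim \<open>0 < T\<close> by (auto simp: h_def)
      let ?S = "martingale_sum h n"
      note m = martingale_sum_second_moment[OF h(1), of n, folded A_def]
      have "real n * (8 * \<sigma>\<^sup>2 * A * h + 4 * \<sigma> ^ 4 * h\<^sup>2) = (real n * h) * (8 * \<sigma>\<^sup>2 * A) + 4 * \<sigma> ^ 4 * (real n * h) * h"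
        by (simp add: algebra_simps power2_eq_square)
      also have "\<dots> \<le> T * (8 * \<sigma>\<^sup>2 * A) + 4 * \<sigma> ^ 4 * T"
        unfolding h(3) using mult_left_mono[OF h(2), of "4 * \<sigma> ^ 4 * T"] \<open>0 < T\<close> by simp
      finally have S_le: "expectation (\<lambda>\<omega>. (?S \<omega>)\<^sup>2) \<le> T * (8 * \<sigma>\<^sup>2 * A) + 4 * \<sigma> ^ 4 * T"
        using m by linarith
      have W4: "integrable M (\<lambda>\<omega>. (W T \<omega>) ^ 4)" "expectation (\<lambda>\<omega>. (W T \<omega>) ^ 4) \<le> A"
        using W_fourth_moment[of T] \<open>0 < T\<close> by (auto simp: A_def)
      have w4: "w ^ 4 \<le> A"
      proof -
        have "1 * (1 + w ^ 4) \<le> moment_constant \<theta> \<sigma> * (1 + w ^ 4)"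
          using moment_constant_ge[of \<theta> \<sigma>] by (intro mult_right_mono) (auto simp: add_nonneg_nonneg)
        then show ?thesis by (simp add: A_def w_def)
      qed
      have E_le: "(E n \<omega>)\<^sup>2 \<le> 3 * ((W T \<omega>) ^ 4 + w ^ 4 + (?S \<omega>)\<^sup>2)" for \<omega>
      proof -
        have "(a - b - c)\<^sup>2 \<le> 3 * (a\<^sup>2 + b\<^sup>2 + c\<^sup>2)" for a b c :: real
          using sum_squares_ge_zero[of "a + b" "a + c"] zero_le_power2[of "b - c"]
          by (simp add: power2_eq_square algebra_simps)
        from this[of "(W T \<omega>)\<^sup>2" "w\<^sup>2" "?S \<omega>"] show ?thesis
          by (simp add: E_def h_def flip: power_mult)
      qed
      have int: "integrable M (\<lambda>\<omega>. 3 * ((W T \<omega>) ^ 4 + w ^ 4 + (?S \<omega>)\<^sup>2))"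
        using W4 m by simp
      have "(\<integral>\<^sup>+\<omega>. ennreal (c * (E n \<omega>)\<^sup>2) \<partial>M) \<le> (\<integral>\<^sup>+\<omega>. ennreal (c * (3 * ((W T \<omega>) ^ 4 + w ^ 4 + (?S \<omega>)\<^sup>2))) \<partial>M)"
        by (intro nn_integral_mono ennreal_leI mult_left_mono E_le \<open>0 \<le> c\<close>)
      also have "\<dots> = ennreal (c * expectation (\<lambda>\<omega>. 3 * ((W T \<omega>) ^ 4 + w ^ 4 + (?S \<omega>)\<^sup>2)))"
        using int \<open>0 \<le> c\<close>
        by (subst nn_integral_eq_integral) (auto intro!: AE_I2 mult_nonneg_nonneg add_nonneg_nonneg)
      also have "expectation (\<lambda>\<omega>. 3 * ((W T \<omega>) ^ 4 + w ^ 4 + (?S \<omega>)\<^sup>2)) =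
          3 * (expectation (\<lambda>\<omega>. (W T \<omega>) ^ 4) + w ^ 4 + expectation (\<lambda>\<omega>. (?S \<omega>)\<^sup>2))"
        using W4 m by (simp add: prob_space)
      also have "ennreal (c * \<dots>) \<le> ennreal (c * (3 * (2 * A + T * (8 * \<sigma>\<^sup>2 * A) + 4 * \<sigma> ^ 4 * T)))"
        using W4(2) w4 S_le \<open>0 \<le> c\<close> by (intro ennreal_leI mult_left_mono) auto
      finally show ?case .
    qed
  qed
  also have "\<dots> = ennreal (c * (3 * (2 * A + T * (8 * \<sigma>\<^sup>2 * A) + 4 * \<sigma> ^ 4 * T)))"
    by (simp add: Liminf_const)
  finally show ?thesis .
qed

end

definition average_constant :: "real \<Rightarrow> real \<Rightarrow> real \<Rightarrow> real" where
  "average_constant \<theta> \<sigma> K =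
    3 * (2 + 8 * \<sigma>\<^sup>2 + 4 * \<sigma> ^ 4) * (1 + moment_constant \<theta> \<sigma> * (9 + 8 * K ^ 4)) / (4 * \<theta>\<^sup>2)"

text \<open>
  The bound of \<open>integral_second_moment\<close>, divided by \<open>4 \<theta>\<^sup>2 T\<^sup>2\<close>, in the required form: the terms without \<open>T\<close>
  are at most \<open>T\<close> times as large, and \<open>(x - r)\<^sup>4 \<le> 8 (\<bar>x\<bar>\<^sup>4 + K\<^sup>4)\<close>.
\<close>

lemma average_constant_bound:
  fixes \<theta> \<sigma> K r x T :: real
  assumes "\<theta> \<noteq> 0" "1 \<le> T" "- K \<le> r" "r \<le> 0" "r \<le> x"
  defines "A \<equiv> 1 + moment_constant \<theta> \<sigma> * (1 + (x - r) ^ 4)"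
  shows "1 / (4 * \<theta>\<^sup>2 * T\<^sup>2) * (3 * (2 * A + T * (8 * \<sigma>\<^sup>2 * A) + 4 * \<sigma> ^ 4 * T))
    \<le> average_constant \<theta> \<sigma> K * (1 + \<bar>x\<bar> ^ 4) / T"
proof -
  define c where "c = 1 / (4 * \<theta>\<^sup>2 * T\<^sup>2)"
  have "0 < T" using assms by simp
  have "0 < c" using assms(1) \<open>0 < T\<close> by (simp add: c_def)
  have m: "0 \<le> moment_constant \<theta> \<sigma>" using moment_constant_ge[of \<theta> \<sigma>] by simp
  then have "1 \<le> A" by (simp add: A_def)
  have x4: "0 \<le> \<bar>x\<bar> ^ 4" by simp
  have "x - r \<le> \<bar>x\<bar> + K" "0 \<le> K" using assms by auto
  then have "(x - r) ^ 4 \<le> (\<bar>x\<bar> + K) ^ 4"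
    using assms(5) by (intro power_mono) auto
  also have "\<dots> \<le> 8 * (\<bar>x\<bar> ^ 4 + K ^ 4)"
  proof -
    have sq: "(u + v)\<^sup>2 \<le> 2 * (u\<^sup>2 + v\<^sup>2)" for u v :: real
      using sum_squares_bound[of u v] by (simp add: power2_sum)
    have "(\<bar>x\<bar> + K) ^ 4 = ((\<bar>x\<bar> + K)\<^sup>2)\<^sup>2" by (simp flip: power_mult)
    also have "\<dots> \<le> (2 * (\<bar>x\<bar>\<^sup>2 + K\<^sup>2))\<^sup>2"
      by (rule power_mono[OF sq]) simp
    also have "\<dots> = 4 * (\<bar>x\<bar>\<^sup>2 + K\<^sup>2)\<^sup>2"
      unfolding power_mult_distrib by simp
    also have "\<dots> \<le> 4 * (2 * ((\<bar>x\<bar>\<^sup>2)\<^sup>2 + (K\<^sup>2)\<^sup>2))"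
      by (rule mult_left_mono[OF sq]) simp
    finally show ?thesis by (simp flip: power_mult)
  qed
  finally have x4_le: "(x - r) ^ 4 \<le> 8 * (\<bar>x\<bar> ^ 4 + K ^ 4)" .
  have "0 \<le> K ^ 4 * \<bar>x\<bar> ^ 4" by (intro mult_nonneg_nonneg) auto
  then have "1 + (x - r) ^ 4 \<le> 9 + 9 * \<bar>x\<bar> ^ 4 + 8 * K ^ 4 + 8 * (K ^ 4 * \<bar>x\<bar> ^ 4)"
    using x4 x4_le unfolding distrib_left by linarith
  also have "\<dots> = (9 + 8 * K ^ 4) * (1 + \<bar>x\<bar> ^ 4)"
    by (simp only: ring_distribs mult_1_right mult.assoc add.assoc)
  finally have "1 + (x - r) ^ 4 \<le> (9 + 8 * K ^ 4) * (1 + \<bar>x\<bar> ^ 4)" .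
  from mult_left_mono[OF this m]
  have A_le: "A \<le> (1 + moment_constant \<theta> \<sigma> * (9 + 8 * K ^ 4)) * (1 + \<bar>x\<bar> ^ 4)"
    using x4 unfolding A_def distrib_right[of 1] mult.assoc mult_1_left by linarith
  have "2 * A + T * (8 * \<sigma>\<^sup>2 * A) + 4 * \<sigma> ^ 4 * T \<le> (2 + 8 * \<sigma>\<^sup>2 + 4 * \<sigma> ^ 4) * A * T"
  proof -
    have "A * 1 \<le> A * T" using \<open>1 \<le> A\<close> assms(2) by (intro mult_left_mono) auto
    moreover have "\<sigma> ^ 4 * T * 1 \<le> \<sigma> ^ 4 * T * A"
      using \<open>1 \<le> A\<close> \<open>0 < T\<close> by (intro mult_left_mono) auto
    ultimately show ?thesis by (simp add: algebra_simps)
  qed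
  also have "\<dots> \<le> (2 + 8 * \<sigma>\<^sup>2 + 4 * \<sigma> ^ 4) *
      ((1 + moment_constant \<theta> \<sigma> * (9 + 8 * K ^ 4)) * (1 + \<bar>x\<bar> ^ 4)) * T"
    using A_le \<open>0 < T\<close> by (intro mult_right_mono mult_left_mono) (auto intro!: add_nonneg_nonneg)
  finally have "c * (3 * (2 * A + T * (8 * \<sigma>\<^sup>2 * A) + 4 * \<sigma> ^ 4 * T)) \<le> c * (3 *
      ((2 + 8 * \<sigma>\<^sup>2 + 4 * \<sigma> ^ 4) * ((1 + moment_constant \<theta> \<sigma> * (9 + 8 * K ^ 4)) * (1 + \<bar>x\<bar> ^ 4)) * T))"
    using \<open>0 < c\<close> by (intro mult_left_mono) auto
  also have "\<dots> = average_constant \<theta> \<sigma> K * (1 + \<bar>x\<bar> ^ 4) / T"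
  proof -
    have "1 / (4 * \<theta>\<^sup>2 * T\<^sup>2) * (3 * (u * (v * w) * T)) = 3 * u * v / (4 * \<theta>\<^sup>2) * w / T" for u v w
      using assms(1) \<open>0 < T\<close> by (simp add: power2_eq_square field_simps)
    then show ?thesis unfolding c_def average_constant_def .
  qed
  finally show "c * (3 * (2 * A + T * (8 * \<sigma>\<^sup>2 * A) + 4 * \<sigma> ^ 4 * T))
      \<le> average_constant \<theta> \<sigma> K * (1 + \<bar>x\<bar> ^ 4) / T"
    unfolding c_def .
qed

lemma (in reflected_brownian) time_average_error:
  assumes "1 \<le> T" "- K \<le> r" "r \<le> 0" "\<gamma> = - 2 * \<theta> / \<sigma>\<^sup>2"
  shows "(\<integral>\<^sup>+\<omega>. ennreal (\<bar>(1 / T) * (\<integral>t\<in>{0..T}. W t \<omega> \<partial>lborel) - 1 / \<gamma>\<bar>\<^sup>2) \<partial>M)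
    \<le> ennreal (average_constant \<theta> \<sigma> K * (1 + \<bar>x\<bar> ^ 4) / T)"
proof -
  define A where "A = 1 + moment_constant \<theta> \<sigma> * (1 + (x - r) ^ 4)"
  define c where "c = 1 / (4 * \<theta>\<^sup>2 * T\<^sup>2)"
  let ?D = "\<lambda>\<omega>. 2 * \<theta> * integral {0..T} (\<lambda>t. W t \<omega>) + \<sigma>\<^sup>2 * T"
  have "0 < T" using assms by simp
  have "0 < c" using drift_neg \<open>0 < T\<close> by (simp add: c_def)
  have "AE \<omega> in M. ennreal (\<bar>(1 / T) * (\<integral>t\<in>{0..T}. W t \<omega> \<partial>lborel) - 1 / \<gamma>\<bar>\<^sup>2)
      = ennreal (c * (?D \<omega>)\<^sup>2)"
    using AE_reflected_path
  proof eventually_elim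
    case (elim \<omega>)
    interpret reflected_path \<theta> \<sigma> r x "\<lambda>t. B t \<omega>" "\<lambda>t. Z t \<omega>" "\<lambda>t. Y t \<omega>" by fact
    have "continuous_on {0..T} (\<lambda>t. W t \<omega>)"
      by (intro continuous_intros continuous_on_subset[OF cont_z]) auto
    then have "(\<integral>t\<in>{0..T}. W t \<omega> \<partial>lborel) = integral {0..T} (\<lambda>t. W t \<omega>)"
      by (intro set_borel_integral_eq_integral(2) borel_integrable_atLeastAtMost')
    moreover have "(1 / T) * v - 1 / \<gamma> = (2 * \<theta> * v + \<sigma>\<^sup>2 * T) / (2 * \<theta> * T)" for v
      unfolding assms(4) using drift_neg \<sigma>_pos \<open>0 < T\<close> by (simp add: field_simps)
    ultimately show ?case
      by (simp add: c_def power_divide power_mult_distrib)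
  qed
  then have "(\<integral>\<^sup>+\<omega>. ennreal (\<bar>(1 / T) * (\<integral>t\<in>{0..T}. W t \<omega> \<partial>lborel) - 1 / \<gamma>\<bar>\<^sup>2) \<partial>M)
      = (\<integral>\<^sup>+\<omega>. ennreal (c * (?D \<omega>)\<^sup>2) \<partial>M)"
    by (rule nn_integral_cong_AE)
  also have "\<dots> \<le> ennreal (c * (3 * (2 * A + T * (8 * \<sigma>\<^sup>2 * A) + 4 * \<sigma> ^ 4 * T)))"
    unfolding A_def using assms(1) \<open>0 < c\<close> by (intro integral_second_moment) auto
  also have "\<dots> \<le> ennreal (average_constant \<theta> \<sigma> K * (1 + \<bar>x\<bar> ^ 4) / T)"
    unfolding A_def c_def
    using assms start_above drift_neg by (intro ennreal_leI average_constant_bound) auto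
  finally show ?thesis .
qed

theorem lemma12:
  fixes \<theta> \<sigma> \<gamma> K_h :: real
  assumes "\<theta> < 0" and "\<sigma> > 0" and "\<gamma> = - 2 * \<theta> / \<sigma>\<^sup>2" and "K_h > 0"
  shows "\<exists>C3::real. \<forall>(M :: 'a measure) F B.
    standard_brownian_motion M F B \<longrightarrow>
    (\<forall>r\<in>{- K_h..0}. \<forall>x\<ge>r. \<forall>T\<ge>1. \<forall>Z Y.
      reflected_brownian_motion M F B \<theta> \<sigma> r x Z Y \<longrightarrow>
      (\<integral>\<^sup>+ \<omega>. ennreal (\<bar>(1 / T) * (\<integral>t\<in>{0..T}. (Z t \<omega> - r) \<partial>lborel) - 1 / \<gamma>\<bar>\<^sup>2) \<partial>M)
        \<le> ennreal (C3 * (1 + \<bar>x\<bar> ^ 4) / T))"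
proof (intro exI allI impI ballI)
  fix M :: "'a measure" and F B and r x T :: real and Z Y
  assume "standard_brownian_motion M F B" "r \<in> {- K_h..0}" "r \<le> x" "1 \<le> T"
    and "reflected_brownian_motion M F B \<theta> \<sigma> r x Z Y"
  then interpret reflected_brownian M F B \<theta> \<sigma> r x Z Y
    using assms by unfold_locales
  show "(\<integral>\<^sup>+ \<omega>. ennreal (\<bar>(1 / T) * (\<integral>t\<in>{0..T}. (Z t \<omega> - r) \<partial>lborel) - 1 / \<gamma>\<bar>\<^sup>2) \<partial>M)
      \<le> ennreal (average_constant \<theta> \<sigma> K_h * (1 + \<bar>x\<bar> ^ 4) / T)"
    using \<open>1 \<le> T\<close> \<open>r \<in> {- K_h..0}\<close> assms(3) by (intro time_average_error) auto
qed

end
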